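(* Let $m$ and $t$ be positive integers satisfying $\binom{t}{3}-6\le m\le \binom{t}{3}-3$. Let $G$ be a $3$-graph with $m$ edges. Then $\lambda(G)\leq\lambda(C_{3,m})$.
   Context: $[n]=\{1,2,\ldots,n\}$. A $3$-graph $G$ consists of a (finite) vertex set, identified with $[n]$ for some $n$, and an edge set $E(G)$ of $3$-subsets of it; a triple $\{p,q,s\}$ is written $pqs$. The Lagrangian of a $3$-graph $G$ on $[n]$ is $\lambda(G)=\max\{\sum_{pqs\in E(G)}x_px_qx_s : x_1+\cdots+x_n=1,\ x_j\ge 0 \text{ for all } j\}$. Colex ordering on $3$-subsets of the positive integers $\mathbb{N}$: for distinct $A,B$, $A<B$ iff $\max(A\triangle B)\in B$, where $\triangle$ denotes symmetric difference. $C_{3,m}$ is the $3$-graph with $m$ edges whose edges are the first $m$ sets in the colex ordering of $\mathbb{N}^{(3)}$, the family of $3$-subsets of $\mathbb{N}$. *)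

theory Defs
  imports "HOL-Analysis.Analysis"
begin

text \<open>A 3-graph on the vertex set \<open>{1..n}\<close> is represented by \<open>n\<close> and its edge set.\<close>

definition three_graph :: "nat \<Rightarrow> nat set set \<Rightarrow> bool" where
  "three_graph n E \<longleftrightarrow> E \<subseteq> {e. e \<subseteq> {1..n} \<and> card e = 3}"

text \<open>Weightings are total functions; only their values on \<open>{1..n}\<close> matter.\<close>

definition weightings :: "nat \<Rightarrow> (nat \<Rightarrow> real) set" where
  "weightings n = {x. (\<Sum>j\<in>{1..n}. x j) = 1 \<and> (\<forall>j\<in>{1..n}. 0 \<le> x j)}"

definition edge_weight :: "nat set set \<Rightarrow> (nat \<Rightarrow> real) \<Rightarrow> real" where
  "edge_weight E x = (\<Sum>e\<in>E. \<Prod>j\<in>e. x j)"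

text \<open>The supremum is a maximum when \<open>n > 0\<close>: see \<open>lagrangian_attained\<close> below.\<close>

definition lagrangian :: "nat \<Rightarrow> nat set set \<Rightarrow> real" where
  "lagrangian n E = (SUP x\<in>weightings n. edge_weight E x)"

definition triples :: "nat set set" where
  "triples = {A. A \<subseteq> {1..} \<and> card A = 3}"

definition colex_less :: "nat set \<Rightarrow> nat set \<Rightarrow> bool" where
  "colex_less A B \<longleftrightarrow> A \<noteq> B \<and> Max (sym_diff A B) \<in> B"

text \<open>A triple is among the first \<open>m\<close> iff it has fewer than \<open>m\<close> predecessors; every
  triple has only finitely many (\<open>finite_colex_predecessors\<close>), so \<open>card\<close> is meaningful here.\<close>

definition colex_edges :: "nat \<Rightarrow> nat set set" where
  "colex_edges m = {A \<in> triples. card {B \<in> triples. colex_less B A} < m}"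

text \<open>The vertex set of the colex graph is \<open>{1..colex_order m}\<close>, without isolated vertices
  at the end (for \<open>m > 0\<close>). Isolated vertices would not change the Lagrangian.\<close>

definition colex_order :: "nat \<Rightarrow> nat" where
  "colex_order m = Max (\<Union> (colex_edges m))"

lemma lagrangian_attained:
  assumes "three_graph n E" "n > 0"
  shows "\<exists>x\<in>weightings n. edge_weight E x = lagrangian n E \<and>
           (\<forall>y\<in>weightings n. edge_weight E y \<le> edge_weight E x)"
proof -
  define K where "K = PiE (UNIV::nat set) (\<lambda>j. if j \<in> {1..n} then {0..1::real} else {0})"
  define S where "S = K \<inter> {x. (\<Sum>j\<in>{1..n}. x j) = 1}"
  have coord: "continuous_on UNIV (\<lambda>x::nat\<Rightarrow>real. x j)" for j
    by (rule continuous_on_product_coordinates)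
  have "compact K"
    unfolding K_def compactin_euclidean_iff[symmetric] euclidean_product_topology[symmetric]
    by (subst compactin_PiE) auto
  moreover have "closed {x::nat\<Rightarrow>real. (\<Sum>j\<in>{1..n}. x j) = 1}"
    by (intro closed_Collect_eq continuous_on_sum coord continuous_on_const)
  ultimately have "compact S"
    unfolding S_def by (rule compact_Int_closed)
  moreover have "(\<lambda>j. if j = 1 then 1 else 0) \<in> S"
    using assms(2) unfolding S_def K_def by (auto simp: PiE_def Pi_def)
  hence "S \<noteq> {}"
    by blast
  moreover have "continuous_on S (edge_weight E)"
    unfolding edge_weight_def
    by (intro continuous_on_sum continuous_on_prod continuous_on_subset[OF coord]) auto
  ultimately obtain x where x: "x \<in> S" "\<And>y. y \<in> S \<Longrightarrow> edge_weight E y \<le> edge_weight E x"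
    using continuous_attains_sup[of S "edge_weight E"] by blast
  have xw: "x \<in> weightings n"
    using x(1) unfolding S_def K_def weightings_def by (force simp: PiE_def Pi_def split: if_splits)
  have le: "edge_weight E y \<le> edge_weight E x" if y: "y \<in> weightings n" for y
  proof -
    define z where "z = (\<lambda>j. if j \<in> {1..n} then y j else 0)"
    have "y j \<le> 1" if "j \<in> {1..n}" for j
      using member_le_sum[of j "{1..n}" y] y that unfolding weightings_def by auto
    moreover have "(\<Sum>j\<in>{1..n}. z j) = (\<Sum>j\<in>{1..n}. y j)"
      unfolding z_def by (rule sum.cong) auto
    ultimately have "z \<in> S"
      using y unfolding S_def K_def weightings_def by (auto simp: z_def)
    moreover have "edge_weight E z = edge_weight E y"
      unfolding edge_weight_def z_def using assms(1) unfolding three_graph_def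
      by (intro sum.cong prod.cong refl) fastforce+
    ultimately show ?thesis
      using x(2) by metis
  qed
  have "lagrangian n E = edge_weight E x"
    unfolding lagrangian_def using xw le by (intro cSup_eq_maximum) auto
  then show ?thesis
    using xw le by auto
qed

lemma colex_less_iff:
  assumes "finite A" "finite B"
  shows "colex_less A B \<longleftrightarrow> (\<exists>k. k \<in> B \<and> k \<notin> A \<and> (\<forall>j>k. j \<in> A \<longleftrightarrow> j \<in> B))"
proof
  assume L: "colex_less A B"
  have fin: "finite (sym_diff A B)" and ne: "sym_diff A B \<noteq> {}"
    using assms L unfolding colex_less_def by auto
  have "Max (sym_diff A B) \<in> sym_diff A B"
    using fin ne by (rule Max_in)
  moreover have "j \<in> A \<longleftrightarrow> j \<in> B" if "j > Max (sym_diff A B)" for j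
    using Max_ge[OF fin, of j] that by auto
  ultimately show "\<exists>k. k \<in> B \<and> k \<notin> A \<and> (\<forall>j>k. j \<in> A \<longleftrightarrow> j \<in> B)"
    using L unfolding colex_less_def by blast
next
  assume "\<exists>k. k \<in> B \<and> k \<notin> A \<and> (\<forall>j>k. j \<in> A \<longleftrightarrow> j \<in> B)"
  then obtain k where k: "k \<in> B" "k \<notin> A" "\<And>j. j > k \<Longrightarrow> j \<in> A \<longleftrightarrow> j \<in> B"
    by blast
  have "Max (sym_diff A B) = k"
    using assms k by (intro Max_eqI) (auto simp: not_less[symmetric])
  with k show "colex_less A B"
    unfolding colex_less_def by blast
qed

lemma finite_triple: "A \<in> triples \<Longrightarrow> finite A"
  unfolding triples_def using card.infinite by fastforce

lemma colex_less_trans: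
  assumes "A \<in> triples" "B \<in> triples" "C \<in> triples" "colex_less A B" "colex_less B C"
  shows "colex_less A C"
proof -
  obtain k where k: "k \<in> B" "k \<notin> A" "\<And>j. j > k \<Longrightarrow> j \<in> A \<longleftrightarrow> j \<in> B"
    using assms colex_less_iff finite_triple by metis
  obtain l where l: "l \<in> C" "l \<notin> B" "\<And>j. j > l \<Longrightarrow> j \<in> B \<longleftrightarrow> j \<in> C"
    using assms colex_less_iff finite_triple by metis
  have "max k l \<in> C \<and> max k l \<notin> A \<and> (\<forall>j > max k l. j \<in> A \<longleftrightarrow> j \<in> C)"
    using k l by (cases k l rule: linorder_cases) auto
  then show ?thesis
    using assms colex_less_iff finite_triple by metis
qed

lemma colex_less_linear:
  assumes "A \<in> triples" "B \<in> triples"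
  shows "colex_less A B \<or> A = B \<or> colex_less B A"
proof -
  have "Max (sym_diff A B) \<in> sym_diff A B" if "A \<noteq> B"
    using assms finite_triple that by (intro Max_in) auto
  moreover have "sym_diff A B = sym_diff B A"
    by blast
  ultimately show ?thesis
    unfolding colex_less_def by auto
qed

lemma colex_less_irrefl: "\<not> colex_less A A"
  by (simp add: colex_less_def)

lemma finite_colex_predecessors:
  assumes "A \<in> triples"
  shows "finite {B \<in> triples. colex_less B A}"
proof -
  have "b \<le> Max A" if B: "B \<in> triples" "colex_less B A" and b: "b \<in> B" for B b
  proof -
    obtain k where k: "k \<in> A" "\<And>j. j > k \<Longrightarrow> j \<in> B \<longleftrightarrow> j \<in> A"
      using B assms colex_less_iff finite_triple by metis
    show ?thesis
      using k b Max_ge[OF finite_triple[OF assms]] by (meson le_trans not_less)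
  qed
  then have "{B \<in> triples. colex_less B A} \<subseteq> Pow {..Max A}"
    by auto
  then show ?thesis
    by (rule finite_subset) simp
qed

lemma colex_rank_strict_mono:
  assumes "A \<in> triples" "B \<in> triples" "colex_less A B"
  shows "card {C \<in> triples. colex_less C A} < card {C \<in> triples. colex_less C B}"
proof (rule psubset_card_mono)
  show "finite {C \<in> triples. colex_less C B}"
    by (rule finite_colex_predecessors[OF assms(2)])
  show "{C \<in> triples. colex_less C A} \<subset> {C \<in> triples. colex_less C B}"
    using assms colex_less_trans colex_less_irrefl by blast
qed

lemma infinite_triples: "infinite triples"
proof -
  have "(\<lambda>n. {1, 2, n + 3}) ` UNIV \<subseteq> triples"
    unfolding triples_def by auto
  moreover have "inj (\<lambda>n::nat. {1, 2, n + 3})"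
    by (rule injI) (auto simp: set_eq_iff)
  ultimately show ?thesis
    using finite_subset range_inj_infinite by metis
qed

lemma colex_edges_initial:
  assumes "A \<in> colex_edges m" "B \<in> triples - colex_edges m"
  shows "colex_less A B"
  using assms colex_less_linear[of A B] colex_rank_strict_mono[of B A]
  unfolding colex_edges_def by auto

lemma finite_card_colex_edges: "finite (colex_edges m) \<and> card (colex_edges m) = m"
proof (induction m)
  case 0
  show ?case
    by (simp add: colex_edges_def)
next
  case (Suc m)
  define r where "r = (\<lambda>A. card {B \<in> triples. colex_less B A})"
  have edges: "colex_edges k = {A \<in> triples. r A < k}" for k
    by (simp add: colex_edges_def r_def)
  have inj: "A = B" if "A \<in> triples" "B \<in> triples" "r A = r B" for A B
    using that colex_less_linear[of A B] colex_rank_strict_mono[of A B]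
      colex_rank_strict_mono[of B A] unfolding r_def by auto
  have "\<exists>A. A \<in> triples - colex_edges m"
    using infinite_triples Suc by (metis Diff_infinite_finite ex_in_conv finite.emptyI)
  then obtain A where A: "A \<in> triples - colex_edges m"
      and least: "\<And>B. B \<in> triples - colex_edges m \<Longrightarrow> r A \<le> r B"
    using ex_has_least_nat[of "\<lambda>A. A \<in> triples - colex_edges m" _ r] by metis
  have "{B \<in> triples. colex_less B A} = colex_edges m"
  proof (intro equalityI subsetI)
    fix B assume B: "B \<in> {B \<in> triples. colex_less B A}"
    then have "r B < r A"
      using colex_rank_strict_mono[of B A] A by (simp add: r_def)
    then show "B \<in> colex_edges m"
      using least[of B] B by auto
  next
    fix B assume "B \<in> colex_edges m"
    then show "B \<in> {B \<in> triples. colex_less B A}"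
      using colex_edges_initial[of B m A] A by (simp add: edges)
  qed
  then have "r A = m"
    using Suc by (simp add: r_def)
  then have "colex_edges (Suc m) = insert A (colex_edges m)"
    using A inj by (auto simp: edges less_Suc_eq)
  then show ?case
    using Suc A by simp
qed

lemma three_graph_colex: "three_graph (colex_order m) (colex_edges m)"
proof -
  have "finite (\<Union> (colex_edges m))"
    using finite_card_colex_edges[of m] finite_triple by (auto simp: colex_edges_def)
  then have "j \<le> Max (\<Union> (colex_edges m))" if "A \<in> colex_edges m" "j \<in> A" for A j
    using that by (intro Max_ge) auto
  moreover have "A \<subseteq> {1..} \<and> card A = 3" if "A \<in> colex_edges m" for A
    using that by (simp add: colex_edges_def triples_def)
  ultimately show ?thesis
    unfolding three_graph_def colex_order_def by fastforce
qed

end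

theory Submission
  imports Defs
begin

text \<open>Let \<open>F\<close> be the set of triples of \<open>{1..n}\<close> that are not edges. By Newton's identities the edge weight
of the graph at a weighting \<open>x\<close> is \<open>1/6 - energy n F x\<close>, where the energy is a sum of one-variable
functions of the weights plus the weight of the few triples in \<open>F\<close>. Maximising the Lagrangian for a
given number of edges means minimising the energy jointly in \<open>F\<close> (of given size) and \<open>x\<close>. Among all
minimising pairs there is one whose weights increase with the label and whose \<open>F\<close> is closed under
replacing a vertex of a triple by a smaller one (\<open>optimal_shifted_exists\<close>). In this labelling, the
reverse of the usual one, the colex graph with \<open>(t choose 3) - a\<close> edges (\<open>a + 2 \<le> t\<close>) has as its
missing triples the star \<open>{1,2,3}, \<dots>, {1,2,a+2}\<close>.

Let the weights be positive and let \<open>F\<close> have at most \<open>min 6 (n - 2)\<close> triples. If the closed set \<open>F\<close> is not a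
star, then some vertex \<open>j\<close> lies in exactly two of its triples, which are \<open>{1,2,j}\<close> and \<open>{1,3,j}\<close>, or \<open>F\<close> is a star
together with \<open>{1,3,4}\<close> and \<open>{2,3,4}\<close>, or \<open>F\<close> consists of the triples that join vertex 1 to the pairs of
\<open>{2,3,4,5}\<close>. In each case an explicit modification of \<open>F\<close> and of the weights
lowers the energy, which contradicts minimality. The modification is found as follows. To first order
an optimal weight falls below that of the vertices outside \<open>F\<close> by an amount proportional to its degree
in \<open>F\<close>. So let \<open>\<delta>\<close> be this deficit per missing triple, read off from one vertex, and subtract from each
weight \<open>\<delta>\<close> times the change of its degree. After the first-order conditions at the old
minimum have been used, what remains is a polynomial inequality that needs no assumption that \<open>n\<close> is large.
Hence stars are optimal (\<open>star_minimises_energy\<close>); if a weight vanishes this is immediate, because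
all triples of the star contain the lightest vertex 1.

The graph may have more than \<open>t\<close> vertices. As long as \<open>n \<ge> 6\<close> and \<open>m \<le> (n - 1 choose 3)\<close>, a vertex can be
discarded (\<open>lagrangian_bound_step\<close>): move the weight of the lightest vertex 1 onto the second lightest vertex 2
and replace the edges at vertex 1 by equally many missing triples. The loss is the square of the moved
weight times the weight of the common neighbours of 1 and 2. Stationarity bounds the heaviest weight,
and there are enough heavy missing triples to make up for the loss (\<open>merge_lightest\<close>).

With \<open>a = (t choose 3) - m\<close>, what is left is to compare with the colex graph. If \<open>a + 2 \<le> t\<close> it contains the
reversed complement of the star. Otherwise \<open>t - 2\<close> missing triples already allow the two lightest
vertices to be merged, and the bound is the Lagrangian of a complete graph on \<open>t - 1\<close> vertices, which the
colex graph contains. This argument is for \<open>t \<ge> 5\<close>; for smaller \<open>t\<close> there is just one edge.\<close>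

section \<open>Sets of triples and their weights\<close>

definition triples_of :: "nat set \<Rightarrow> nat set set" where
  "triples_of V = {e. e \<subseteq> V \<and> card e = 3}"

lemma finite_triples_of: "finite V \<Longrightarrow> finite (triples_of V)"
  unfolding triples_of_def by (rule finite_subset[of _ "Pow V"]) auto

lemma finite_edge: "e \<in> triples_of V \<Longrightarrow> finite e"
  unfolding triples_of_def using card.infinite by fastforce

lemma card_triples_of: "finite V \<Longrightarrow> card (triples_of V) = card V choose 3"
  unfolding triples_of_def by (rule n_subsets)

lemma in_triples_of_iff:
  "e \<in> triples_of V \<longleftrightarrow> (\<exists>a b c. e = {a, b, c} \<and> a < b \<and> b < c \<and> a \<in> V \<and> b \<in> V \<and> c \<in> V)"
proof
  assume e: "e \<in> triples_of V"
  then obtain a b c where abc: "e = {a, b, c}" "a \<noteq> b" "b \<noteq> c" "a \<noteq> c"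
    unfolding triples_of_def by (auto simp: card_3_iff)
  have V: "a \<in> V" "b \<in> V" "c \<in> V"
    using e abc unfolding triples_of_def by auto
  show "\<exists>a b c. e = {a, b, c} \<and> a < b \<and> b < c \<and> a \<in> V \<and> b \<in> V \<and> c \<in> V"
    using abc V by (metis insert_commute linorder_neqE_nat)
next
  show "\<exists>a b c. e = {a, b, c} \<and> a < b \<and> b < c \<and> a \<in> V \<and> b \<in> V \<and> c \<in> V \<Longrightarrow> e \<in> triples_of V"
    unfolding triples_of_def by auto
qed

lemma edge_weight_diff:
  assumes "finite A" "B \<subseteq> A"
  shows "edge_weight (A - B) x = edge_weight A x - edge_weight B x"
  using assms unfolding edge_weight_def by (simp add: sum_diff)

lemma edge_weight_union:
  assumes "finite A" "finite B" "A \<inter> B = {}"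
  shows "edge_weight (A \<union> B) x = edge_weight A x + edge_weight B x"
  using assms unfolding edge_weight_def by (simp add: sum.union_disjoint)

lemma edge_weight_mono:
  assumes "finite B" "A \<subseteq> B" "\<And>e i. e \<in> B \<Longrightarrow> i \<in> e \<Longrightarrow> 0 \<le> x i"
  shows "edge_weight A x \<le> edge_weight B x"
  unfolding edge_weight_def using assms by (intro sum_mono2 prod_nonneg) auto

lemma edge_weight_cong:
  assumes "\<And>e i. e \<in> A \<Longrightarrow> i \<in> e \<Longrightarrow> x i = y i"
  shows "edge_weight A x = edge_weight A y"
  unfolding edge_weight_def using assms by (intro sum.cong prod.cong refl) auto

lemma edge_weight_image:
  assumes "inj_on f V" "A \<subseteq> triples_of V"
  shows "edge_weight ((`) f ` A) x = edge_weight A (x \<circ> f)"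
proof -
  have "inj_on ((`) f) A"
  proof (rule inj_onI)
    fix d e assume "d \<in> A" "e \<in> A" "f ` d = f ` e"
    moreover from this have "d \<subseteq> V" "e \<subseteq> V"
      using assms(2) by (auto simp: triples_of_def)
    ultimately show "d = e"
      using inj_on_image_eq_iff[OF assms(1)] by blast
  qed
  then have "edge_weight ((`) f ` A) x = (\<Sum>e\<in>A. \<Prod>j\<in>f ` e. x j)"
    unfolding edge_weight_def by (simp add: sum.reindex)
  also have "\<dots> = edge_weight A (x \<circ> f)"
    unfolding edge_weight_def
    using assms by (intro sum.cong refl) (metis (no_types, lifting) inj_on_subset mem_Collect_eq
        prod.reindex subsetD triples_of_def)
  finally show ?thesis .
qed

lemma image_triples_of:
  assumes "bij_betw f V W"
  shows "(`) f ` triples_of V = triples_of W"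
proof (intro equalityI subsetI)
  fix e assume "e \<in> (`) f ` triples_of V"
  then show "e \<in> triples_of W"
    using assms unfolding triples_of_def bij_betw_def by (auto simp: card_image inj_on_subset)
next
  fix e assume e: "e \<in> triples_of W"
  define d where "d = inv_into V f ` e"
  have "bij_betw (inv_into V f) W V"
    by (rule bij_betw_inv_into[OF assms])
  then have "d \<in> triples_of V"
    using e unfolding d_def triples_of_def bij_betw_def by (auto simp: card_image inj_on_subset)
  moreover have "f ` d = e"
    using e assms unfolding d_def triples_of_def bij_betw_def
    by (auto simp: image_image f_inv_into_f subset_iff intro!: image_eqI)
  ultimately show "e \<in> (`) f ` triples_of V"
    by blast
qed

section \<open>The energy of a weighting\<close>

lemma pair_sum:
  fixes x :: "nat \<Rightarrow> real"
  assumes "finite V"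
  shows "2 * (\<Sum>e\<in>{e. e \<subseteq> V \<and> card e = 2}. \<Prod>j\<in>e. x j) = (\<Sum>j\<in>V. x j)\<^sup>2 - (\<Sum>j\<in>V. (x j)\<^sup>2)"
  using assms
proof (induction V)
  case empty
  have "{e. e \<subseteq> {} \<and> card e = 2} = ({} :: nat set set)" by auto
  then show ?case by (simp only:) simp
next
  case (insert v V)
  have split: "{e. e \<subseteq> insert v V \<and> card e = 2} = {e. e \<subseteq> V \<and> card e = 2} \<union> (\<lambda>j. {v, j}) ` V"
    (is "?L = ?A \<union> ?B")
    using insert.hyps by (auto simp: card_2_iff doubleton_eq_iff)
  have fin: "finite ?A"
    by (rule finite_subset[of _ "Pow V"]) (use insert.hyps(1) in auto)
  have "(\<Sum>e\<in>?B. \<Prod>j\<in>e. x j) = (\<Sum>j\<in>V. \<Prod>j\<in>{v, j}. x j)"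
    by (subst sum.reindex) (auto simp: inj_on_def doubleton_eq_iff)
  also have "\<dots> = (\<Sum>j\<in>V. x v * x j)"
  proof (rule sum.cong)
    fix j assume "j \<in> V"
    then have "v \<noteq> j" using insert.hyps by auto
    then show "(\<Prod>j\<in>{v, j}. x j) = x v * x j" by simp
  qed simp
  also have "\<dots> = x v * (\<Sum>j\<in>V. x j)"
    by (simp add: sum_distrib_left)
  finally have B: "(\<Sum>e\<in>?B. \<Prod>j\<in>e. x j) = x v * (\<Sum>j\<in>V. x j)" .
  have "(\<Sum>e\<in>?L. \<Prod>j\<in>e. x j) = (\<Sum>e\<in>?A. \<Prod>j\<in>e. x j) + (\<Sum>e\<in>?B. \<Prod>j\<in>e. x j)"
    unfolding split using insert.hyps fin by (intro sum.union_disjoint) auto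
  then show ?case
    using insert.IH insert.hyps unfolding B by (simp add: power2_eq_square algebra_simps)
qed

text \<open>Newton's identity for the third elementary symmetric polynomial, which is the edge weight of the complete
3-graph. The quadratic case above is needed for its induction step.\<close>

lemma triple_sum:
  fixes x :: "nat \<Rightarrow> real"
  assumes "finite V"
  shows "6 * edge_weight (triples_of V) x =
    (\<Sum>j\<in>V. x j) ^ 3 - 3 * (\<Sum>j\<in>V. x j) * (\<Sum>j\<in>V. (x j)\<^sup>2) + 2 * (\<Sum>j\<in>V. x j ^ 3)"
  using assms
proof (induction V)
  case empty
  have "triples_of {} = {}" by (auto simp: triples_of_def)
  then show ?case by (simp add: edge_weight_def)
next
  case (insert v V)
  let ?P = "{e. e \<subseteq> V \<and> card e = 2}"
  have split: "triples_of (insert v V) = triples_of V \<union> insert v ` ?P"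
  proof (intro equalityI subsetI)
    fix e assume e: "e \<in> triples_of (insert v V)"
    show "e \<in> triples_of V \<union> insert v ` ?P"
    proof (cases "v \<in> e")
      case True
      have "e - {v} \<in> ?P" "e = insert v (e - {v})"
        using e True finite_edge[OF e] by (auto simp: triples_of_def)
      then show ?thesis by blast
    next
      case False
      then show ?thesis using e by (auto simp: triples_of_def)
    qed
  next
    fix e assume "e \<in> triples_of V \<union> insert v ` ?P"
    moreover have "insert v d \<in> triples_of (insert v V)" if "d \<in> ?P" for d
    proof -
      have "finite d" using that insert.hyps(1) finite_subset by auto
      then show ?thesis using that insert.hyps(2) by (auto simp: triples_of_def card_insert_if)
    qed
    ultimately show "e \<in> triples_of (insert v V)"
      by (auto simp: triples_of_def)
  qed
  have fin: "finite ?P"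
    by (rule finite_subset[of _ "Pow V"]) (use insert.hyps(1) in auto)
  have "edge_weight (insert v ` ?P) x = (\<Sum>d\<in>?P. \<Prod>j\<in>insert v d. x j)"
    unfolding edge_weight_def using insert.hyps
    by (subst sum.reindex) (auto simp: inj_on_def insert_ident subset_iff)
  also have "\<dots> = (\<Sum>d\<in>?P. x v * (\<Prod>j\<in>d. x j))"
    using insert.hyps finite_subset by (intro sum.cong refl prod.insert) auto
  also have "\<dots> = x v * (\<Sum>d\<in>?P. \<Prod>j\<in>d. x j)"
    by (simp add: sum_distrib_left)
  finally have B: "edge_weight (insert v ` ?P) x = x v * (\<Sum>d\<in>?P. \<Prod>j\<in>d. x j)" .
  have "edge_weight (triples_of (insert v V)) x = edge_weight (triples_of V) x + edge_weight (insert v ` ?P) x"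
    unfolding split using insert.hyps fin finite_triples_of
    by (intro edge_weight_union) (auto simp: triples_of_def)
  then have "6 * edge_weight (triples_of (insert v V)) x =
      6 * edge_weight (triples_of V) x + 3 * x v * (2 * (\<Sum>d\<in>?P. \<Prod>j\<in>d. x j))"
    unfolding B by simp
  then show ?case
    unfolding insert.IH pair_sum[OF insert.hyps(1)] using insert.hyps
    by (simp add: power2_eq_square power3_eq_cube algebra_simps)
qed

text \<open>On a weighting the power sum of degree 1 is 1, so the third elementary symmetric polynomial is
\<open>1/6\<close> minus the sum of this function over the weights.\<close>

definition profile :: "real \<Rightarrow> real" where
  "profile s = s\<^sup>2 / 2 - s ^ 3 / 3"

definition energy :: "nat \<Rightarrow> nat set set \<Rightarrow> (nat \<Rightarrow> real) \<Rightarrow> real" where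
  "energy n F x = (\<Sum>i\<in>{1..n}. profile (x i)) + edge_weight F x"

text \<open>This turns the maximisation over graphs with few missing triples into a minimisation in which only
the missing triples interact.\<close>

lemma edge_weight_complement:
  assumes "F \<subseteq> triples_of {1..n}" "x \<in> weightings n"
  shows "edge_weight (triples_of {1..n} - F) x = 1 / 6 - energy n F x"
proof -
  have "(\<Sum>j\<in>{1..n}. x j) = 1"
    using assms(2) by (simp add: weightings_def)
  then have "6 * edge_weight (triples_of {1..n}) x = 1 - 6 * (\<Sum>i\<in>{1..n}. profile (x i))"
    using triple_sum[of "{1..n}" x]
    by (simp add: profile_def sum_subtractf sum_divide_distrib[symmetric])
  then show ?thesis
    using edge_weight_diff[of "triples_of {1..n}" F x] assms(1) finite_triples_of[of "{1..n}"]
    by (simp add: energy_def)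
qed

section \<open>Moving weight between two vertices\<close>

text \<open>The first and the mixed second partial derivatives of the edge weight, which is linear in
each variable.\<close>

definition link_weight :: "nat set set \<Rightarrow> nat \<Rightarrow> (nat \<Rightarrow> real) \<Rightarrow> real" where
  "link_weight F i x = (\<Sum>e\<in>{e\<in>F. i \<in> e}. \<Prod>l\<in>e - {i}. x l)"

definition codegree_weight :: "nat set set \<Rightarrow> nat \<Rightarrow> nat \<Rightarrow> (nat \<Rightarrow> real) \<Rightarrow> real" where
  "codegree_weight F i j x = (\<Sum>e\<in>{e\<in>F. i \<in> e \<and> j \<in> e}. \<Prod>l\<in>e - {i, j}. x l)"

lemma edge_weight_update:
  assumes "finite F" "\<forall>e\<in>F. finite e"
  shows "edge_weight F (x(i := v)) = edge_weight F x + (v - x i) * link_weight F i x"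
proof -
  let ?I = "{e\<in>F. i \<in> e}"
  have F: "edge_weight F y = (\<Sum>e\<in>?I. y i * (\<Prod>l\<in>e - {i}. y l)) + (\<Sum>e\<in>F - ?I. \<Prod>l\<in>e. y l)" for y
  proof -
    have "edge_weight F y = (\<Sum>e\<in>?I. \<Prod>l\<in>e. y l) + (\<Sum>e\<in>F - ?I. \<Prod>l\<in>e. y l)"
      unfolding edge_weight_def using assms(1) by (subst sum.subset_diff[of ?I F]) auto
    moreover have "(\<Prod>l\<in>e. y l) = y i * (\<Prod>l\<in>e - {i}. y l)" if "e \<in> ?I" for e
      using that assms(2) by (intro prod.remove) auto
    ultimately show ?thesis by simp
  qed
  have 1: "(\<Sum>e\<in>F - ?I. \<Prod>l\<in>e. (x(i := v)) l) = (\<Sum>e\<in>F - ?I. \<Prod>l\<in>e. x l)"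
    by (intro sum.cong prod.cong refl) auto
  have 2: "(\<Sum>e\<in>?I. (x(i := v)) i * (\<Prod>l\<in>e - {i}. (x(i := v)) l)) = (\<Sum>e\<in>?I. v * (\<Prod>l\<in>e - {i}. x l))"
    by (intro sum.cong refl) (auto intro!: prod.cong)
  show ?thesis
    unfolding F[of "x(i := v)"] F[of x] 1 2 link_weight_def
    by (simp add: sum_distrib_left[symmetric] algebra_simps)
qed

lemma link_weight_update:
  assumes "finite F" "\<forall>e\<in>F. finite e" "i \<noteq> j"
  shows "link_weight F j (x(i := v)) = link_weight F j x + (v - x i) * codegree_weight F i j x"
proof -
  let ?G = "{e\<in>F. j \<in> e}" and ?D = "\<lambda>e. e - {j}"
  have inj: "inj_on ?D {e\<in>F. j \<in> e}"
    by (auto simp: inj_on_def)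
  have L: "link_weight F j y = edge_weight (?D ` ?G) y" for y
    unfolding link_weight_def edge_weight_def by (simp add: sum.reindex[OF inj])
  have "{d \<in> ?D ` ?G. i \<in> d} = ?D ` {e\<in>F. i \<in> e \<and> j \<in> e}"
    using assms(3) by auto
  then have "link_weight (?D ` ?G) i x = (\<Sum>e\<in>{e\<in>F. i \<in> e \<and> j \<in> e}. \<Prod>l\<in>e - {j} - {i}. x l)"
    unfolding link_weight_def
    by (simp add: sum.reindex inj_on_subset[OF inj, of "{e\<in>F. i \<in> e \<and> j \<in> e}"] Collect_mono_iff)
  also have "\<dots> = codegree_weight F i j x"
    unfolding codegree_weight_def by (intro sum.cong prod.cong refl) auto
  finally have C: "link_weight (?D ` ?G) i x = codegree_weight F i j x" .
  show ?thesis
    unfolding L C[symmetric] using assms(1,2) by (intro edge_weight_update) auto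
qed

lemma edge_weight_move:
  assumes "finite F" "\<forall>e\<in>F. finite e" "i \<noteq> j"
  shows "edge_weight F (x(i := x i + s, j := x j - s)) =
    edge_weight F x + s * (link_weight F i x - link_weight F j x) - s\<^sup>2 * codegree_weight F i j x"
proof -
  have "edge_weight F (x(i := x i + s, j := x j - s)) =
      edge_weight F (x(i := x i + s)) + (x j - s - x j) * link_weight F j (x(i := x i + s))"
    using edge_weight_update[OF assms(1,2), of "x(i := x i + s)" j "x j - s"] assms(3) by simp
  moreover have "edge_weight F (x(i := x i + s)) = edge_weight F x + s * link_weight F i x"
    using edge_weight_update[OF assms(1,2), of x i "x i + s"] by simp
  moreover have "link_weight F j (x(i := x i + s)) = link_weight F j x + s * codegree_weight F i j x"
    using link_weight_update[OF assms, of x "x i + s"] by simp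
  ultimately show ?thesis
    by (simp only:) (simp add: algebra_simps power2_eq_square)
qed

lemma sum_local_change:
  fixes f g :: "nat \<Rightarrow> real"
  assumes "finite V" "S \<subseteq> V" "\<And>i. i \<in> V - S \<Longrightarrow> f i = g i"
  shows "(\<Sum>i\<in>V. f i) = (\<Sum>i\<in>V. g i) + (\<Sum>i\<in>S. f i - g i)"
  using assms sum.subset_diff[OF assms(2,1), of f] sum.subset_diff[OF assms(2,1), of g]
  by (simp add: sum_subtractf)

text \<open>The cubic terms of the two profiles cancel, so along such a move the energy is a quadratic
polynomial, and its first-order term is the difference of the partial derivatives.\<close>

lemma energy_move:
  assumes "F \<subseteq> triples_of {1..n}" "i \<noteq> j" "i \<in> {1..n}" "j \<in> {1..n}"
  shows "energy n F (x(i := x i + s, j := x j - s)) = energy n F x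
    + s * ((x i - (x i)\<^sup>2 + link_weight F i x) - (x j - (x j)\<^sup>2 + link_weight F j x))
    + s\<^sup>2 * (1 - x i - x j - codegree_weight F i j x)"
proof -
  have F: "finite F" "\<forall>e\<in>F. finite e"
    using assms(1) finite_triples_of[of "{1..n}"] finite_edge finite_subset by blast+
  let ?y = "x(i := x i + s, j := x j - s)"
  have "(\<Sum>l\<in>{1..n}. profile (?y l)) = (\<Sum>l\<in>{1..n}. profile (x l)) + (\<Sum>l\<in>{i,j}. profile (?y l) - profile (x l))"
    using assms by (intro sum_local_change) auto
  also have "(\<Sum>l\<in>{i,j}. profile (?y l) - profile (x l)) =
      s * ((x i - (x i)\<^sup>2) - (x j - (x j)\<^sup>2)) + s\<^sup>2 * (1 - x i - x j)"
    using assms(2) by (simp add: profile_def power2_eq_square power3_eq_cube field_simps)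
  finally have "(\<Sum>l\<in>{1..n}. profile (?y l)) = (\<Sum>l\<in>{1..n}. profile (x l)) +
      (s * ((x i - (x i)\<^sup>2) - (x j - (x j)\<^sup>2)) + s\<^sup>2 * (1 - x i - x j))" .
  note profiles = this
  show ?thesis
    unfolding energy_def profiles edge_weight_move[OF F assms(2), of x s] by (simp add: algebra_simps)
qed

lemma weightings_move:
  assumes "x \<in> weightings n" "i \<noteq> j" "i \<in> {1..n}" "j \<in> {1..n}" "- x i \<le> s" "s \<le> x j"
  shows "x(i := x i + s, j := x j - s) \<in> weightings n"
proof -
  let ?y = "x(i := x i + s, j := x j - s)"
  have "(\<Sum>l\<in>{1..n}. ?y l) = (\<Sum>l\<in>{1..n}. x l) + (\<Sum>l\<in>{i,j}. ?y l - x l)"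
    using assms by (intro sum_local_change) auto
  then show ?thesis
    using assms unfolding weightings_def by auto
qed

section \<open>Optimal pairs and stationarity\<close>

text \<open>Minimality is required jointly in the missing triples and in the weights: the set of missing triples
may also be replaced by any other of the same size.\<close>

definition optimal :: "nat \<Rightarrow> nat set set \<Rightarrow> (nat \<Rightarrow> real) \<Rightarrow> bool" where
  "optimal n F x \<longleftrightarrow> F \<subseteq> triples_of {1..n} \<and> x \<in> weightings n \<and>
     (\<forall>F' y. F' \<subseteq> triples_of {1..n} \<longrightarrow> card F' = card F \<longrightarrow> y \<in> weightings n \<longrightarrow>
        energy n F x \<le> energy n F' y)"

lemma linear_coefficient_zero:
  fixes b c \<eta> :: real
  assumes "0 < \<eta>" "\<And>s. \<bar>s\<bar> \<le> \<eta> \<Longrightarrow> 0 \<le> s * b + s\<^sup>2 * c"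
  shows "b = 0"
proof (rule ccontr)
  assume b: "b \<noteq> 0"
  define r where "r = min \<eta> (\<bar>b\<bar> / (2 * (\<bar>c\<bar> + 1)))"
  have r: "0 < r" "r \<le> \<eta>" "r * (2 * (\<bar>c\<bar> + 1)) \<le> \<bar>b\<bar>"
  proof -
    have c: "0 < 2 * (\<bar>c\<bar> + 1)" by simp
    show "0 < r" "r \<le> \<eta>"
      using assms(1) b by (auto simp: r_def intro!: divide_pos_pos)
    have "r \<le> \<bar>b\<bar> / (2 * (\<bar>c\<bar> + 1))" by (simp add: r_def)
    then show "r * (2 * (\<bar>c\<bar> + 1)) \<le> \<bar>b\<bar>"
      by (simp only: pos_le_divide_eq[OF c])
  qed
  have "0 \<le> (- sgn b * r) * b + (- sgn b * r)\<^sup>2 * c"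
    using r b by (intro assms(2)) (auto simp: abs_mult)
  also have "(- sgn b * r) * b + (- sgn b * r)\<^sup>2 * c = r * (r * c - \<bar>b\<bar>)"
    using b by (auto simp: sgn_if power2_eq_square algebra_simps)
  finally have "\<bar>b\<bar> \<le> r * c"
    using r(1) by (simp add: zero_le_mult_iff)
  also have "\<dots> \<le> r * \<bar>c\<bar>"
    using r(1) by simp
  finally have "\<bar>b\<bar> \<le> r * \<bar>c\<bar>" .
  moreover have "r * (2 * (\<bar>c\<bar> + 1)) = 2 * (r * \<bar>c\<bar>) + 2 * r"
    by (simp add: algebra_simps)
  moreover have "0 \<le> r * \<bar>c\<bar>"
    using r by simp
  ultimately show False
    using r by linarith
qed

text \<open>The Lagrange condition for two positive weights: the move between the two vertices is possible in
both directions, so its first-order term vanishes.\<close>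

lemma optimal_stationary:
  assumes "optimal n F x" "i \<noteq> j" "i \<in> {1..n}" "j \<in> {1..n}" "0 < x i" "0 < x j"
  shows "(x j - x i) * (1 - x i - x j) = link_weight F i x - link_weight F j x"
proof -
  define b where "b = (x i - (x i)\<^sup>2 + link_weight F i x) - (x j - (x j)\<^sup>2 + link_weight F j x)"
  have "b = 0"
  proof (rule linear_coefficient_zero)
    show "0 < min (x i) (x j)" using assms by simp
  next
    fix s assume "\<bar>s\<bar> \<le> min (x i) (x j)"
    then have "x(i := x i + s, j := x j - s) \<in> weightings n"
      using assms by (intro weightings_move) (auto simp: optimal_def)
    then have "energy n F x \<le> energy n F (x(i := x i + s, j := x j - s))"
      using assms(1) by (auto simp: optimal_def)
    then show "0 \<le> s * b + s\<^sup>2 * (1 - x i - x j - codegree_weight F i j x)"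
      using energy_move[of F n i j x s] assms unfolding b_def by (auto simp: optimal_def)
  qed
  then show ?thesis
    unfolding b_def by (simp add: algebra_simps power2_eq_square)
qed

section \<open>Local improvements\<close>

lemma weightings_sum_le:
  assumes "x \<in> weightings n" "S \<subseteq> {1..n}"
  shows "(\<Sum>i\<in>S. x i) \<le> 1"
proof -
  have "(\<Sum>i\<in>S. x i) \<le> (\<Sum>i\<in>{1..n}. x i)"
    using assms by (intro sum_mono2) (auto simp: weightings_def)
  then show ?thesis
    using assms(1) by (simp add: weightings_def)
qed

lemma optimal_le:
  assumes "optimal n F x" "F' \<subseteq> triples_of {1..n}" "card F' = card F" "y \<in> weightings n"
  shows "energy n F x \<le> energy n F' y"
  using assms unfolding optimal_def by blast

lemma finite_triples_on:
  assumes "F \<subseteq> triples_of {1..n}"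
  shows "finite F" "\<forall>e\<in>F. finite e"
  using assms finite_triples_of[of "{1..n}"] finite_edge finite_subset by blast+

lemma edge_weight_swap:
  assumes "finite F" "e \<in> F" "e' \<notin> F"
  shows "edge_weight (insert e' (F - {e})) x = edge_weight F x - (\<Prod>i\<in>e. x i) + (\<Prod>i\<in>e'. x i)"
    and "card (insert e' (F - {e})) = card F"
proof -
  show "edge_weight (insert e' (F - {e})) x = edge_weight F x - (\<Prod>i\<in>e. x i) + (\<Prod>i\<in>e'. x i)"
    using assms unfolding edge_weight_def by (simp add: sum_diff1)
  have "card (insert e' (F - {e})) = Suc (card (F - {e}))"
    using assms by simp
  then show "card (insert e' (F - {e})) = card F"
    using card_Suc_Diff1[OF assms(1,2)] by (rule trans)
qed

text \<open>The change of energy in \<open>optimal_no_twin_edges\<close>: \<open>u\<close>, \<open>p\<close>, \<open>q\<close> are weights of vertices with these names,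
\<open>z\<close> is the weight of \<open>k\<close>, and \<open>z - 2 * \<delta>\<close> is the weight of \<open>j\<close>. The equation is stationarity between \<open>j\<close> and \<open>k\<close>.\<close>

lemma swap_gain:
  fixes u p q \<delta> z C :: real
  assumes "0 < \<delta>" "2 * \<delta> \<le> u" "u \<le> p" "p \<le> q" "q \<le> z - 2 * \<delta>" "u \<le> C"
    and stat: "2 * \<delta> * (1 - (z - 2 * \<delta>) - z) = u * (p + q)"
  shows "\<delta>\<^sup>2 * (1 - q - p - C) + \<delta>\<^sup>2 * (1 - (z - 2 * \<delta>) - z)
    < u * (q + \<delta>) * (z - 2 * \<delta> + \<delta>) - u * (p - \<delta>) * (z - \<delta>)"
proof -
  have "\<delta>\<^sup>2 * (1 - q - p - C) \<le> \<delta>\<^sup>2 * (1 - q - p - u)"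
    using assms by (intro mult_left_mono) auto
  moreover have "u * (q + \<delta>) * (z - 2 * \<delta> + \<delta>) - u * (p - \<delta>) * (z - \<delta>)
      - \<delta>\<^sup>2 * (1 - q - p - u) - \<delta>\<^sup>2 * (1 - (z - 2 * \<delta>) - z)
      = u * (z - \<delta>) * (q - p) + \<delta> * (2 * z - 2 * \<delta> - p - q) * (u - \<delta>) + \<delta>\<^sup>2 * u"
    using stat by algebra
  moreover have "0 \<le> u * (z - \<delta>) * (q - p)" "0 \<le> \<delta> * (2 * z - 2 * \<delta> - p - q) * (u - \<delta>)"
    using assms by (auto intro!: mult_nonneg_nonneg)
  moreover have "0 < \<delta>\<^sup>2 * u"
    using assms by (intro mult_pos_pos) auto
  ultimately show ?thesis
    by linarith
qed

text \<open>If \<open>{u,p,j}\<close> and \<open>{u,q,j}\<close> are the only missing triples at \<open>j\<close> and none is at \<open>k\<close>, then it is better to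
replace \<open>{u,q,j}\<close> by \<open>{u,p,k}\<close>. This makes the missing triples more star-like, and it is accompanied by a
move of \<open>\<delta>\<close> from \<open>p\<close> to \<open>q\<close> and from \<open>k\<close> to \<open>j\<close>. Stationarity removes the first-order terms of both moves;
the second-order terms are smaller than the gain from the replacement.\<close>

lemma optimal_no_twin_edges:
  assumes opt: "optimal n F x" and pos: "\<forall>i\<in>{1..n}. 0 < x i"
    and dist: "distinct [u, p, q, j, k]" and V: "{u, p, q, j, k} \<subseteq> {1..n}"
    and upq: "{u, p, q} \<in> F"
    and Fj: "{e\<in>F. j \<in> e} = {{u, p, j}, {u, q, j}}" and Fk: "{e\<in>F. k \<in> e} = {}"
    and ord: "x u \<le> x p" "x p \<le> x q" "x q \<le> x j" "x j \<le> x k"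
  shows False
proof -
  have FV: "F \<subseteq> triples_of {1..n}" and xw: "x \<in> weightings n"
    using opt by (auto simp: optimal_def)
  note fin = finite_triples_on[OF FV]
  have ne': "q \<noteq> p" "j \<noteq> k"
    using dist by auto
  have pos': "0 < x u" "0 < x p" "0 < x q" "0 < x j" "0 < x k"
    using pos V by auto
  have "(\<Sum>i\<in>{u, p, q, j, k}. x i) \<le> 1"
    using xw V by (rule weightings_sum_le)
  then have sum: "x u + x p + x q + x j + x k \<le> 1"
    using dist by simp
  have ne: "{u, p, j} \<noteq> {u, q, j}"
    using dist by (auto simp: insert_eq_iff doubleton_eq_iff)
  have linkj: "link_weight F j y = y u * y p + y u * y q" for y
  proof -
    have "{u, p, j} - {j} = {u, p}" "{u, q, j} - {j} = {u, q}"
      using dist by auto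
    then show ?thesis
      unfolding link_weight_def Fj using ne dist by simp
  qed
  have linkk: "link_weight F k y = 0" for y
    unfolding link_weight_def Fk by simp
  \<comment> \<open>The vertex \<open>j\<close> has degree 2 in \<open>F\<close>, so this is the deficit per missing triple.\<close>
  define \<delta> where "\<delta> = (x k - x j) / 2"
  have "2 * \<delta> = x k - x j"
    by (simp add: \<delta>_def)
  then have xj: "x j = x k - 2 * \<delta>"
    by linarith
  have stat': "(x k - x j) * (1 - x j - x k) = x u * (x p + x q)"
    using optimal_stationary[OF opt, of j k] V dist pos' linkj linkk by (simp add: distrib_left)
  have stat: "2 * \<delta> * (1 - (x k - 2 * \<delta>) - x k) = x u * (x p + x q)"
    using stat' unfolding xj by simp
  have "0 < x u * (x p + x q)"
    using pos' by simp
  moreover have "0 < 1 - (x k - 2 * \<delta>) - x k"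
    using sum pos' unfolding xj[symmetric] by linarith
  ultimately have "0 < 2 * \<delta>"
    unfolding stat[symmetric] by (rule zero_less_mult_pos2)
  then have d0: "0 < \<delta>" by simp
  have "2 * \<delta> * (x p + x q) \<le> 2 * \<delta> * (1 - (x k - 2 * \<delta>) - x k)"
    using d0 sum pos' unfolding xj[symmetric] by (intro mult_left_mono) auto
  then have "2 * \<delta> * (x p + x q) \<le> x u * (x p + x q)"
    using stat by simp
  then have du: "2 * \<delta> \<le> x u"
    using pos' by (simp add: mult_le_cancel_right)
  define y where "y = x(q := x q + \<delta>, p := x p - \<delta>)"
  define w where "w = y(j := y j + \<delta>, k := y k - \<delta>)"
  have y: "y u = x u" "y p = x p - \<delta>" "y q = x q + \<delta>" "y j = x j" "y k = x k"
    using dist by (auto simp: y_def)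
  have w: "w u = x u" "w p = x p - \<delta>" "w q = x q + \<delta>" "w j = x j + \<delta>" "w k = x k - \<delta>"
    using dist y by (auto simp: w_def)
  have yw: "y \<in> weightings n"
    unfolding y_def using xw V dist du ord d0 pos' by (intro weightings_move) auto
  have ww: "w \<in> weightings n"
    unfolding w_def using yw V dist du ord d0 y pos' by (intro weightings_move) auto
  define C where "C = codegree_weight F q p x"
  have "x u \<le> C"
  proof -
    have "(\<Sum>e\<in>{{u, p, q}}. \<Prod>l\<in>e - {q, p}. x l) \<le> C"
      unfolding C_def codegree_weight_def
    proof (rule sum_mono2)
      show "finite {e\<in>F. q \<in> e \<and> p \<in> e}" using fin by simp
      show "{{u, p, q}} \<subseteq> {e\<in>F. q \<in> e \<and> p \<in> e}" using upq by auto
      show "0 \<le> (\<Prod>l\<in>e - {q, p}. x l)" if "e \<in> {e\<in>F. q \<in> e \<and> p \<in> e} - {{u, p, q}}" for e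
      proof (rule prod_nonneg)
        fix l assume "l \<in> e - {q, p}"
        then have "l \<in> {1..n}"
          using that FV unfolding triples_of_def by blast
        then show "0 \<le> x l"
          using pos less_imp_le by blast
      qed
    qed
    moreover have "{u, p, q} - {q, p} = {u}"
      using dist by auto
    ultimately show ?thesis by simp
  qed
  have "(x q - (x q)\<^sup>2 + link_weight F q x) - (x p - (x p)\<^sup>2 + link_weight F p x) = 0"
    using optimal_stationary[OF opt, of q p] V ne' pos' by (simp add: algebra_simps power2_eq_square)
  then have Ey: "energy n F y = energy n F x + \<delta>\<^sup>2 * (1 - x q - x p - C)"
    using energy_move[OF FV, of q p x \<delta>] V ne' unfolding y_def C_def by simp
  have cod: "codegree_weight F j k y = 0"
  proof -
    have none: "{e\<in>F. j \<in> e \<and> k \<in> e} = {}" using Fk by auto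
    show ?thesis unfolding codegree_weight_def none by simp
  qed
  have "(x j - (x j)\<^sup>2 + x u * (x p + x q)) - (x k - (x k)\<^sup>2) = 0"
    using stat' by (simp add: algebra_simps power2_eq_square)
  moreover have "link_weight F j y = x u * (x p + x q)"
    unfolding linkj y by (simp add: algebra_simps)
  ultimately have Ew: "energy n F w = energy n F y + \<delta>\<^sup>2 * (1 - x j - x k)"
    using energy_move[OF FV, of j k y \<delta>] V ne' cod unfolding w_def y linkk by simp
  have uqj: "{u, q, j} \<in> F" and upk: "{u, p, k} \<notin> F"
    using Fj Fk by auto
  let ?F = "insert {u, p, k} (F - {{u, q, j}})"
  have "{u, p, k} \<in> triples_of {1..n}"
    using V dist by (simp add: triples_of_def)
  then have "?F \<subseteq> triples_of {1..n}"
    using FV by blast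
  then have "energy n F x \<le> energy n ?F w"
    using opt ww edge_weight_swap(2)[OF fin(1) uqj upk] unfolding optimal_def by blast
  also have "\<dots> = energy n F w - x u * (x q + \<delta>) * (x j + \<delta>) + x u * (x p - \<delta>) * (x k - \<delta>)"
  proof -
    have "(\<Prod>i\<in>{u, q, j}. w i) = x u * (x q + \<delta>) * (x j + \<delta>)"
      using dist w by simp
    moreover have "(\<Prod>i\<in>{u, p, k}. w i) = x u * (x p - \<delta>) * (x k - \<delta>)"
      using dist w by simp
    ultimately show ?thesis
      unfolding energy_def edge_weight_swap(1)[OF fin(1) uqj upk] by simp
  qed
  finally have "0 \<le> \<delta>\<^sup>2 * (1 - x q - x p - C) + \<delta>\<^sup>2 * (1 - x j - x k)
      - x u * (x q + \<delta>) * (x j + \<delta>) + x u * (x p - \<delta>) * (x k - \<delta>)"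
    using Ey Ew by simp
  moreover have "\<delta>\<^sup>2 * (1 - x q - x p - C) + \<delta>\<^sup>2 * (1 - (x k - 2 * \<delta>) - x k)
      < x u * (x q + \<delta>) * (x k - 2 * \<delta> + \<delta>) - x u * (x p - \<delta>) * (x k - \<delta>)"
    using d0 du ord \<open>x u \<le> C\<close> stat unfolding xj by (intro swap_gain) auto
  ultimately show False
    unfolding xj by linarith
qed

text \<open>For \<open>m \<le> n\<close> these are the triples of \<open>{1..n}\<close> missing from a colex graph, with the order of the vertices reversed.\<close>

definition star :: "nat \<Rightarrow> nat set set" where
  "star m = (\<lambda>i. {1, 2, i}) ` {3..m}"

lemma inj_on_star: "inj_on (\<lambda>i. {1, 2, i}) {3..m::nat}"
  by (rule inj_onI) (auto simp: insert_eq_iff doubleton_eq_iff)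

lemma star_subset: "m \<le> n \<Longrightarrow> star m \<subseteq> triples_of {1..n}"
  by (auto simp: star_def triples_of_def)

lemma card_star: "card (star m) = m - 2"
  unfolding star_def by (simp add: card_image[OF inj_on_star] del: One_nat_def)

lemma edge_weight_star: "edge_weight (star m) x = x 1 * x 2 * (\<Sum>i\<in>{3..m}. x i)"
proof -
  have "edge_weight (star m) x = (\<Sum>i\<in>{3..m}. \<Prod>l\<in>{1, 2, i}. x l)"
    unfolding edge_weight_def star_def by (simp add: sum.reindex[OF inj_on_star] del: One_nat_def)
  also have "\<dots> = (\<Sum>i\<in>{3..m}. x 1 * x 2 * x i)"
    by (intro sum.cong) auto
  finally show ?thesis
    by (simp add: sum_distrib_left)
qed

text \<open>The inequality behind \<open>optimal_not_clique_star\<close>. There \<open>p\<close> is the weight of the vertices 1 and 2, \<open>q\<close> that of 3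
and 4, \<open>z\<close> that of the vertices outside \<open>F\<close>, and \<open>Q\<close> is the total weight of the leaves of the star. With
\<open>x = q - p\<close> the gain is a sum of nonnegative terms, once the two stationarity conditions have been added with
multipliers \<open>- 2 * \<delta>\<close> and \<open>2 * \<delta>\<close>.\<close>

lemma clique_star_gain:
  fixes p q \<delta> z Q :: real
  assumes "0 < p" "p \<le> q" and q: "q = z - 3 * \<delta>"
    and sum: "2 * p + Q + 2 * z \<le> 1" and Q: "2 * q \<le> Q" "Q \<le> 2 * q + 2 * z"
    and statp: "(z - p) * (1 - p - z) = p * Q + q\<^sup>2"
    and statq: "3 * \<delta> * (1 - q - z) = p\<^sup>2 + 2 * p * q"
    and z: "q \<le> z"
  shows "0 < \<delta>" "\<delta> \<le> p"
    and "2 * (profile (p - \<delta>) - profile p) + 2 * (profile (q + 2 * \<delta>) - profile q)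
      + 2 * (profile (z - \<delta>) - profile z) + (p - \<delta>)\<^sup>2 * (Q + 2 * z + 2 * \<delta>) < p\<^sup>2 * Q + 2 * p * q\<^sup>2"
proof -
  have "0 < p\<^sup>2 + 2 * p * q"
    using assms(1,2) by (intro add_pos_pos mult_pos_pos) auto
  moreover have "0 < 1 - q - z"
    using sum Q assms(1,2) z by linarith
  ultimately have "0 < 3 * \<delta>"
    unfolding statq[symmetric] by (rule zero_less_mult_pos2)
  then show d: "0 < \<delta>" by simp
  have "3 * \<delta> * (p + 2 * q) \<le> 3 * \<delta> * (1 - q - z)"
    using d sum Q assms(1,2) z by (intro mult_left_mono) auto
  then have "3 * \<delta> * (p + 2 * q) \<le> p * (p + 2 * q)"
    unfolding statq by (simp add: power2_eq_square algebra_simps)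
  then have dp: "3 * \<delta> \<le> p"
    using assms(1,2) by (simp add: mult_le_cancel_right)
  then show "\<delta> \<le> p"
    using d by simp
  have z6: "6 * \<delta> \<le> z"
    using dp assms(2) q by simp
  define x where "x = q - p"
  have x: "0 \<le> x"
    using assms(2) by (simp add: x_def)
  have "p\<^sup>2 * Q + 2 * p * q\<^sup>2 - (p - \<delta>)\<^sup>2 * (Q + 2 * z + 2 * \<delta>)
      - 2 * (profile (p - \<delta>) - profile p) - 2 * (profile (q + 2 * \<delta>) - profile q)
      - 2 * (profile (z - \<delta>) - profile z)
      = 2 * z * x * (p - \<delta>) + 14 * z * \<delta>\<^sup>2 - 58 * \<delta> ^ 3 - 12 * x * \<delta>\<^sup>2 - \<delta>\<^sup>2 * Q
        - 2 * \<delta> * ((z - p) * (1 - p - z) - (p * Q + q\<^sup>2))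
        + 2 * \<delta> * (3 * \<delta> * (1 - q - z) - (p\<^sup>2 + 2 * p * q))"
    unfolding x_def q profile_def by (simp add: field_simps power2_eq_square power3_eq_cube)
  also have "\<dots> = 2 * z * x * (p - \<delta>) + 14 * z * \<delta>\<^sup>2 - 58 * \<delta> ^ 3 - 12 * x * \<delta>\<^sup>2 - \<delta>\<^sup>2 * Q"
    unfolding statp statq by simp
  also have "\<dots> = 2 * z * x * (p - 3 * \<delta>) + 2 * x * \<delta> * (2 * z - 6 * \<delta>)
      + \<delta>\<^sup>2 * (14 * z - 58 * \<delta> - Q)"
    by (simp add: algebra_simps power2_eq_square power3_eq_cube)
  finally have gain: "p\<^sup>2 * Q + 2 * p * q\<^sup>2 - (p - \<delta>)\<^sup>2 * (Q + 2 * z + 2 * \<delta>)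
      - 2 * (profile (p - \<delta>) - profile p) - 2 * (profile (q + 2 * \<delta>) - profile q)
      - 2 * (profile (z - \<delta>) - profile z) = \<dots>" .
  have "0 \<le> 2 * z * x * (p - 3 * \<delta>)" "0 \<le> 2 * x * \<delta> * (2 * z - 6 * \<delta>)"
    using d dp z6 x by (auto intro!: mult_nonneg_nonneg)
  moreover have "0 < \<delta>\<^sup>2 * (14 * z - 58 * \<delta> - Q)"
    using d z6 Q q by (intro mult_pos_pos) auto
  ultimately show "2 * (profile (p - \<delta>) - profile p) + 2 * (profile (q + 2 * \<delta>) - profile q)
      + 2 * (profile (z - \<delta>) - profile z) + (p - \<delta>)\<^sup>2 * (Q + 2 * z + 2 * \<delta>) < p\<^sup>2 * Q + 2 * p * q\<^sup>2"
    using gain by linarith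
qed

text \<open>For vertices \<open>i\<close> and \<open>j\<close> that an automorphism of \<open>F\<close> exchanges, the difference of the link weights is a multiple
of \<open>x j - x i\<close> with \<open>c\<close> the weight of their common links. A third vertex \<open>l\<close> outside these links makes the weights equal.\<close>

lemma optimal_weights_equal:
  assumes opt: "optimal n F x" and pos: "\<forall>i\<in>{1..n}. 0 < x i"
    and ij: "i \<in> {1..n}" "j \<in> {1..n}" "l \<in> {1..n}" "i \<noteq> j" "l \<noteq> i" "l \<noteq> j"
    and link: "link_weight F i x - link_weight F j x = (x j - x i) * c"
    and c: "c + x i + x j + x l \<le> 1"
  shows "x i = x j"
proof -
  have "(x j - x i) * (1 - x i - x j - c) = 0"
    using optimal_stationary[OF opt, of i j] ij pos link by (simp add: algebra_simps)
  moreover have "0 < x l"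
    using pos ij(3) by blast
  then have "1 - x i - x j - c \<noteq> 0"
    using c by linarith
  ultimately show ?thesis
    by simp
qed

lemma link_weight_eq:
  assumes "F \<subseteq> triples_of {1..n}"
  shows "link_weight F i x = edge_weight F (x(i := x i + 1)) - edge_weight F x"
  using edge_weight_update[OF finite_triples_on[OF assms], of x i "x i + 1"] by simp

text \<open>A star together with \<open>{1,3,4}\<close> and \<open>{2,3,4}\<close> contains all triples of \<open>{1,2,3,4}\<close>. Replacing the two extra
triples by new leaves raises the degrees of 1, 2 and of the new leaves by one and lowers those of 3 and 4 by
two. For \<open>m = 4\<close> the two minimal energies agree to second order, so the comparison has to be exact.\<close>

lemma optimal_not_clique_star:
  assumes opt: "optimal n F x" and pos: "\<forall>i\<in>{1..n}. 0 < x i"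
    and ord: "\<And>i j. 1 \<le> i \<Longrightarrow> i \<le> j \<Longrightarrow> j \<le> n \<Longrightarrow> x i \<le> x j"
    and F: "F = star m \<union> {{1, 3, 4}, {2, 3, 4}}" and m: "4 \<le> m" "m \<le> 6" "m + 2 \<le> n"
  shows False
proof -
  have FV: "F \<subseteq> triples_of {1..n}" and xw: "x \<in> weightings n"
    using opt by (auto simp: optimal_def)
  have ne: "{1, 3, 4} \<noteq> {2, 3, 4::nat}"
    by auto
  have Fw: "edge_weight F y = y 1 * y 2 * (\<Sum>i\<in>{3..m}. y i) + (y 1 + y 2) * y 3 * y 4" for y
  proof -
    have "edge_weight F y = edge_weight (star m) y + edge_weight {{1, 3, 4}, {2, 3, 4}} y"
      unfolding F by (intro edge_weight_union) (auto simp: star_def insert_eq_iff doubleton_eq_iff)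
    also have "edge_weight {{1, 3, 4}, {2, 3, 4}} y = (y 1 + y 2) * y 3 * y 4"
      unfolding edge_weight_def using ne by (simp add: algebra_simps del: One_nat_def)
    finally show ?thesis
      unfolding edge_weight_star .
  qed
  define Q where "Q = (\<Sum>i\<in>{3..m}. x i)"
  have Qupd: "(\<Sum>i\<in>{3..m}. (x(l := v)) i) = Q" if "l \<notin> {3..m}" for l v
    unfolding Q_def using that by (intro sum.cong) auto
  have Qupd': "(\<Sum>i\<in>{3..m}. (x(l := x l + 1)) i) = Q + 1" if "l \<in> {3..m}" for l
    unfolding Q_def using that sum_local_change[of "{3..m}" "{l}" "x(l := x l + 1)" x] by simp
  note link = link_weight_eq[OF FV] Fw
  have l1: "link_weight F 1 x = x 2 * Q + x 3 * x 4"
    unfolding link using Qupd[of 1] by (simp add: algebra_simps Q_def)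
  have l2: "link_weight F 2 x = x 1 * Q + x 3 * x 4"
    unfolding link using Qupd[of 2] by (simp add: algebra_simps Q_def)
  have l3: "link_weight F 3 x = x 1 * x 2 + (x 1 + x 2) * x 4"
    unfolding link using Qupd'[of 3] m by (simp add: algebra_simps Q_def)
  have l4: "link_weight F 4 x = x 1 * x 2 + (x 1 + x 2) * x 3"
    unfolding link using Qupd'[of 4] m by (simp add: algebra_simps Q_def)
  have lk: "link_weight F l x = 0" if "m < l" for l
    unfolding link using Qupd[of l] that m by (simp add: algebra_simps Q_def)
  have Q34: "Q = x 3 + x 4 + (\<Sum>i\<in>{5..m}. x i)"
    unfolding Q_def using m by (simp add: sum.atLeast_Suc_atMost numeral_eq_Suc)
  have "(\<Sum>i\<in>{1..m + 2}. x i) \<le> 1"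
    using xw m by (intro weightings_sum_le) auto
  moreover have "(\<Sum>i\<in>{1..m + 2}. x i) = x 1 + x 2 + Q + x (m + 1) + x (m + 2)"
    unfolding Q_def using m by (simp add: sum.atLeast_Suc_atMost numeral_eq_Suc)
  ultimately have sum: "x 1 + x 2 + Q + x (m + 1) + x (m + 2) \<le> 1"
    by simp
  have p: "0 < x 1" "0 < x 2" "0 < x 3" "0 < x 4" "0 < x (m + 1)" "0 < x (m + 2)"
    using pos m by auto
  have rest: "0 \<le> (\<Sum>i\<in>{5..m}. x i)"
    using pos m by (intro sum_nonneg) (auto intro: less_imp_le)
  have e12: "x 1 = x 2"
    using m l1 l2 sum p rest
    by (intro optimal_weights_equal[OF opt pos, of 1 2 "m + 1" Q]) (auto simp: algebra_simps)
  have e34: "x 3 = x 4"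
    using m l3 l4 sum p rest Q34
    by (intro optimal_weights_equal[OF opt pos, of 3 4 "m + 1" "x 1 + x 2"]) (auto simp: algebra_simps)
  have ek: "x (m + 1) = x (m + 2)"
    using m lk sum p rest Q34
    by (intro optimal_weights_equal[OF opt pos, of "m + 1" "m + 2" 1 0]) auto
  define pp q z where "pp = x 1" and "q = x 3" and "z = x (m + 1)"
  have xs: "x 1 = pp" "x 2 = pp" "x 3 = q" "x 4 = q" "x (m + 1) = z" "x (m + 2) = z"
    using e12 e34 ek by (auto simp: pp_def q_def z_def)
  \<comment> \<open>The vertex 3 has degree 3 in \<open>F\<close>.\<close>
  define \<delta> where "\<delta> = (z - q) / 3"
  have "(\<Sum>i\<in>{5..m}. x i) \<le> of_nat (card {5..m}) * z"
    using ord m unfolding z_def by (intro sum_bounded_above) auto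
  also have "\<dots> \<le> 2 * z"
    using m p unfolding z_def by (intro mult_right_mono) auto
  finally have rest2: "(\<Sum>i\<in>{5..m}. x i) \<le> 2 * z" .
  have "3 * \<delta> = z - q"
    by (simp add: \<delta>_def)
  then have q: "q = z - 3 * \<delta>"
    by linarith
  have Qq: "2 * q \<le> Q" "Q \<le> 2 * q + 2 * z"
    using Q34 rest rest2 xs by auto
  have statp: "(z - pp) * (1 - pp - z) = pp * Q + q\<^sup>2"
    using optimal_stationary[OF opt, of 1 "m + 1"] m p l1 lk[of "m + 1"] xs
    by (simp add: power2_eq_square)
  have statq: "3 * \<delta> * (1 - q - z) = pp\<^sup>2 + 2 * pp * q"
    using optimal_stationary[OF opt, of 3 "m + 1"] m p l3 lk[of "m + 1"] xs
    by (simp add: power2_eq_square \<delta>_def algebra_simps)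
  have ordq: "0 < pp" "pp \<le> q" "q \<le> z"
    using p ord[of 1 3] ord[of 3 "m + 1"] m by (auto simp: pp_def q_def z_def)
  have sum': "2 * pp + Q + 2 * z \<le> 1"
    using sum xs by simp
  note gain = clique_star_gain[OF ordq(1,2) q sum' Qq statp statq ordq(3)]
  define y where "y = x(1 := pp - \<delta>, 2 := pp - \<delta>, 3 := q + 2 * \<delta>, 4 := q + 2 * \<delta>,
    m + 1 := z - \<delta>, m + 2 := z - \<delta>)"
  let ?S = "{1, 2, 3, 4, m + 1, m + 2}"
  have y: "y 1 = pp - \<delta>" "y 2 = pp - \<delta>" "y 3 = q + 2 * \<delta>" "y 4 = q + 2 * \<delta>"
    "y (m + 1) = z - \<delta>" "y (m + 2) = z - \<delta>"
    unfolding y_def using m by auto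
  have S: "(\<Sum>i\<in>?S. f i) = f 1 + f 2 + f 3 + f 4 + f (m + 1) + f (m + 2)" for f :: "nat \<Rightarrow> real"
    using m by simp
  have out: "y i = x i" if "i \<notin> ?S" for i
    using that by (auto simp: y_def)
  have SV: "?S \<subseteq> {1..n}"
    using m by auto
  have yw: "y \<in> weightings n"
  proof -
    have "(\<Sum>i\<in>{1..n}. y i) = (\<Sum>i\<in>{1..n}. x i) + (\<Sum>i\<in>?S. y i - x i)"
      using SV out by (intro sum_local_change) auto
    then have "(\<Sum>i\<in>{1..n}. y i) = 1"
      unfolding S y xs using xw by (simp add: weightings_def)
    moreover have "0 \<le> y i" if "i \<in> {1..n}" for i
      using that pos gain(1,2) ordq q out[of i] y by (cases "i \<in> ?S") (auto simp: less_imp_le)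
    ultimately show ?thesis
      by (simp add: weightings_def)
  qed
  have "(\<Sum>i\<in>{3..m}. y i) = Q + (\<Sum>i\<in>{3, 4}. y i - x i)"
    unfolding Q_def using m out by (intro sum_local_change) auto
  then have "(\<Sum>i\<in>{3..m}. y i) = Q + 4 * \<delta>"
    using y xs by simp
  then have "(\<Sum>i\<in>{3..m + 2}. y i) = Q + 2 * z + 2 * \<delta>"
    using m y by (simp add: sum.cl_ivl_Suc)
  then have Ey: "energy n (star (m + 2)) y =
      (\<Sum>i\<in>{1..n}. profile (y i)) + (pp - \<delta>)\<^sup>2 * (Q + 2 * z + 2 * \<delta>)"
    unfolding energy_def edge_weight_star y by (simp add: power2_eq_square)
  have "(\<Sum>i\<in>{1..n}. profile (y i)) = (\<Sum>i\<in>{1..n}. profile (x i)) + (\<Sum>i\<in>?S. profile (y i) - profile (x i))"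
    using SV out by (intro sum_local_change) auto
  then have P: "(\<Sum>i\<in>{1..n}. profile (y i)) = (\<Sum>i\<in>{1..n}. profile (x i))
      + 2 * (profile (pp - \<delta>) - profile pp) + 2 * (profile (q + 2 * \<delta>) - profile q)
      + 2 * (profile (z - \<delta>) - profile z)"
    unfolding S y xs by simp
  have "edge_weight F x = pp\<^sup>2 * Q + 2 * pp * q\<^sup>2"
    unfolding Fw xs Q_def[symmetric] by (simp add: power2_eq_square)
  then have "energy n F x = (\<Sum>i\<in>{1..n}. profile (x i)) + (pp\<^sup>2 * Q + 2 * pp * q\<^sup>2)"
    by (simp add: energy_def)
  then have "energy n (star (m + 2)) y < energy n F x"
    using gain(3) Ey P by linarith
  moreover have "card F = card (star (m + 2))"
  proof -
    have "card F = card (star m) + card {{1, 3, 4}, {2, 3, 4::nat}}"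
      unfolding F by (rule card_Un_disjoint) (auto simp: star_def insert_eq_iff doubleton_eq_iff)
    then show ?thesis
      using m ne by (simp add: card_star del: One_nat_def)
  qed
  ultimately show False
    using optimal_le[OF opt star_subset _ yw, of "m + 2"] m by simp
qed

text \<open>The inequality behind \<open>optimal_not_link_clique\<close>: \<open>u\<close> is the weight of vertex 1, \<open>q\<close> that of the vertices 2 to 5
and \<open>z\<close> that of the vertices 6 to 8.\<close>

lemma link_clique_gain:
  fixes u q z \<delta> :: real
  assumes "0 < u" "u \<le> q" and q: "q = z - 3 * \<delta>" and z: "q \<le> z"
    and sum: "u + 4 * q + 3 * z \<le> 1" and stat: "\<delta> * (1 - q - z) = u * q"
  shows "0 < \<delta>" "3 * \<delta> \<le> q"
    and "(profile (q - 3 * \<delta>) - profile q) + 3 * (profile (q + 2 * \<delta>) - profile q)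
      + 3 * (profile (z - \<delta>) - profile z) + u * (q - 3 * \<delta>) * (3 * (q + 2 * \<delta>) + 3 * (z - \<delta>))
      < 6 * u * q\<^sup>2"
proof -
  have "0 < u * q"
    using assms(1,2) by simp
  moreover have "0 < 1 - q - z"
    using sum assms(1,2) z by linarith
  ultimately show d: "0 < \<delta>"
    unfolding stat[symmetric] by (rule zero_less_mult_pos2)
  have "\<delta> * (5 * q) \<le> \<delta> * (1 - q - z)"
    using d sum assms(1,2) z by (intro mult_left_mono) auto
  then have "5 * \<delta> * q \<le> u * q"
    unfolding stat by simp
  then have du: "5 * \<delta> \<le> u"
    using assms(1,2) by (simp add: mult_le_cancel_right)
  then show "3 * \<delta> \<le> q"
    using d assms(2) by linarith
  have "6 * u * q\<^sup>2 - u * (q - 3 * \<delta>) * (3 * (q + 2 * \<delta>) + 3 * (z - \<delta>))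
      - (profile (q - 3 * \<delta>) - profile q) - 3 * (profile (q + 2 * \<delta>) - profile q)
      - 3 * (profile (z - \<delta>) - profile z)
      = 3 * u * z * \<delta> + 27 * u * \<delta>\<^sup>2 - 29 * \<delta> ^ 3 - 3 * \<delta> * (\<delta> * (1 - q - z) - u * q)"
    unfolding q profile_def by (simp add: field_simps power2_eq_square power3_eq_cube)
  also have "\<dots> = 3 * u * z * \<delta> + \<delta>\<^sup>2 * (27 * u - 29 * \<delta>)"
    unfolding stat by (simp add: algebra_simps power2_eq_square power3_eq_cube)
  finally have gain: "6 * u * q\<^sup>2 - u * (q - 3 * \<delta>) * (3 * (q + 2 * \<delta>) + 3 * (z - \<delta>))
      - (profile (q - 3 * \<delta>) - profile q) - 3 * (profile (q + 2 * \<delta>) - profile q)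
      - 3 * (profile (z - \<delta>) - profile z) = \<dots>" .
  have "0 < 3 * u * z * \<delta>"
    using assms d by simp
  moreover have "0 \<le> \<delta>\<^sup>2 * (27 * u - 29 * \<delta>)"
    using d du by (intro mult_nonneg_nonneg) auto
  ultimately show "(profile (q - 3 * \<delta>) - profile q) + 3 * (profile (q + 2 * \<delta>) - profile q)
      + 3 * (profile (z - \<delta>) - profile z) + u * (q - 3 * \<delta>) * (3 * (q + 2 * \<delta>) + 3 * (z - \<delta>))
      < 6 * u * q\<^sup>2"
    using gain by linarith
qed

text \<open>If the link of vertex 1 in \<open>F\<close> is the complete graph on \<open>{2,3,4,5}\<close>, the six triples are replaced by a star with
six leaves. The degree of 2 rises by three, those of 3, 4, 5 fall by two, and the new leaves 6, 7, 8 gain one.\<close>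

lemma optimal_not_link_clique:
  assumes opt: "optimal n F x" and pos: "\<forall>i\<in>{1..n}. 0 < x i"
    and ord: "\<And>i j. 1 \<le> i \<Longrightarrow> i \<le> j \<Longrightarrow> j \<le> n \<Longrightarrow> x i \<le> x j"
    and F: "F = {{1, 2, 3}, {1, 2, 4}, {1, 2, 5}, {1, 3, 4}, {1, 3, 5}, {1, 4, 5}}" and n: "8 \<le> n"
  shows False
proof -
  have FV: "F \<subseteq> triples_of {1..n}" and xw: "x \<in> weightings n"
    using opt by (auto simp: optimal_def)
  have dist: "distinct [{1, 2, 3}, {1, 2, 4}, {1, 2, 5}, {1, 3, 4}, {1, 3, 5}, {1, 4, 5::nat}]"
    by (simp add: set_eq_subset)
  have Fset: "F = set [{1, 2, 3}, {1, 2, 4}, {1, 2, 5}, {1, 3, 4}, {1, 3, 5}, {1, 4, 5}]"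
    unfolding F by (simp only: list.set)
  have Fw: "edge_weight F y = y 1 * (y 2 * y 3 + y 2 * y 4 + y 2 * y 5 + y 3 * y 4 + y 3 * y 5 + y 4 * y 5)" for y
    unfolding Fset edge_weight_def sum.distinct_set_conv_list[OF dist]
    by (simp add: algebra_simps del: One_nat_def)
  have cardF: "card F = 6"
    unfolding Fset using distinct_card[OF dist] by simp
  note link = link_weight_eq[OF FV] Fw
  have l2: "link_weight F 2 x = x 1 * (x 3 + x 4 + x 5)"
    unfolding link by (simp add: algebra_simps)
  have l3: "link_weight F 3 x = x 1 * (x 2 + x 4 + x 5)"
    unfolding link by (simp add: algebra_simps)
  have l4: "link_weight F 4 x = x 1 * (x 2 + x 3 + x 5)"
    unfolding link by (simp add: algebra_simps)
  have l5: "link_weight F 5 x = x 1 * (x 2 + x 3 + x 4)"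
    unfolding link by (simp add: algebra_simps)
  have lk: "link_weight F l x = 0" if "l \<in> {6, 7, 8}" for l
    unfolding link using that by auto
  have p: "0 < x 1" "0 < x 2" "0 < x 3" "0 < x 4" "0 < x 5" "0 < x 6" "0 < x 7" "0 < x 8"
    using pos n by auto
  let ?S = "{1, 2, 3, 4, 5, 6, 7, 8}"
  have SV: "?S \<subseteq> {1..n}"
    using n by auto
  have S: "(\<Sum>i\<in>?S. f i) = f 1 + f 2 + f 3 + f 4 + f 5 + f 6 + f 7 + f 8" for f :: "nat \<Rightarrow> real"
    by simp
  have sum: "x 1 + x 2 + x 3 + x 4 + x 5 + x 6 + x 7 + x 8 \<le> 1"
    using weightings_sum_le[OF xw SV] unfolding S .
  have e23: "x 2 = x 3"
    using n l2 l3 sum p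
    by (intro optimal_weights_equal[OF opt pos, of 2 3 6 "x 1"]) (auto simp: algebra_simps)
  have e34: "x 3 = x 4"
    using n l3 l4 sum p
    by (intro optimal_weights_equal[OF opt pos, of 3 4 6 "x 1"]) (auto simp: algebra_simps)
  have e45: "x 4 = x 5"
    using n l4 l5 sum p
    by (intro optimal_weights_equal[OF opt pos, of 4 5 6 "x 1"]) (auto simp: algebra_simps)
  have e67: "x 6 = x 7"
    using n lk sum p by (intro optimal_weights_equal[OF opt pos, of 6 7 1 0]) auto
  have e78: "x 7 = x 8"
    using n lk sum p by (intro optimal_weights_equal[OF opt pos, of 7 8 1 0]) auto
  define u q z where "u = x 1" and "q = x 2" and "z = x 6"
  have xs: "x 1 = u" "x 2 = q" "x 3 = q" "x 4 = q" "x 5 = q" "x 6 = z" "x 7 = z" "x 8 = z"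
    using e23 e34 e45 e67 e78 by (auto simp: u_def q_def z_def)
  \<comment> \<open>The vertices 2, 3, 4, 5 have degree 3 in \<open>F\<close>.\<close>
  define \<delta> where "\<delta> = (z - q) / 3"
  have "3 * \<delta> = z - q"
    by (simp add: \<delta>_def)
  then have q: "q = z - 3 * \<delta>"
    by linarith
  have stat: "\<delta> * (1 - q - z) = u * q"
  proof -
    have "(z - q) * (1 - q - z) = u * (3 * q)"
      using optimal_stationary[OF opt, of 2 6] n p l2 lk[of 6] xs by simp
    then have "3 * (\<delta> * (1 - q - z)) = 3 * (u * q)"
      unfolding \<delta>_def by simp
    then show ?thesis by simp
  qed
  have ordq: "0 < u" "u \<le> q" "q \<le> z"
    using p ord[of 1 2] ord[of 2 6] n by (auto simp: u_def q_def z_def)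
  have sum': "u + 4 * q + 3 * z \<le> 1"
    using sum xs by simp
  note gain = link_clique_gain[OF ordq(1,2) q ordq(3) sum' stat]
  define y where "y = x(2 := q - 3 * \<delta>, 3 := q + 2 * \<delta>, 4 := q + 2 * \<delta>, 5 := q + 2 * \<delta>,
    6 := z - \<delta>, 7 := z - \<delta>, 8 := z - \<delta>)"
  have y: "y 1 = u" "y 2 = q - 3 * \<delta>" "y 3 = q + 2 * \<delta>" "y 4 = q + 2 * \<delta>" "y 5 = q + 2 * \<delta>"
    "y 6 = z - \<delta>" "y 7 = z - \<delta>" "y 8 = z - \<delta>"
    unfolding y_def using xs by auto
  have out: "y i = x i" if "i \<notin> ?S" for i
    using that by (auto simp: y_def)
  have yw: "y \<in> weightings n"
  proof -
    have "(\<Sum>i\<in>{1..n}. y i) = (\<Sum>i\<in>{1..n}. x i) + (\<Sum>i\<in>?S. y i - x i)"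
      using SV out by (intro sum_local_change) auto
    then have "(\<Sum>i\<in>{1..n}. y i) = 1"
      unfolding S y xs using xw by (simp add: weightings_def)
    moreover have "0 \<le> y i" if "i \<in> {1..n}" for i
      using that pos gain(1,2) ordq q out[of i] y by (cases "i \<in> ?S") (auto simp: less_imp_le)
    ultimately show ?thesis
      by (simp add: weightings_def)
  qed
  have "{3..8::nat} = {3, 4, 5, 6, 7, 8}"
    by auto
  then have Ey: "energy n (star 8) y = (\<Sum>i\<in>{1..n}. profile (y i))
      + u * (q - 3 * \<delta>) * (3 * (q + 2 * \<delta>) + 3 * (z - \<delta>))"
    unfolding energy_def edge_weight_star by (simp add: y del: One_nat_def)
  have "(\<Sum>i\<in>{1..n}. profile (y i)) = (\<Sum>i\<in>{1..n}. profile (x i)) + (\<Sum>i\<in>?S. profile (y i) - profile (x i))"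
    using SV out by (intro sum_local_change) auto
  then have P: "(\<Sum>i\<in>{1..n}. profile (y i)) = (\<Sum>i\<in>{1..n}. profile (x i))
      + (profile (q - 3 * \<delta>) - profile q) + 3 * (profile (q + 2 * \<delta>) - profile q)
      + 3 * (profile (z - \<delta>) - profile z)"
    unfolding S y xs by simp
  have "edge_weight F x = 6 * u * q\<^sup>2"
    unfolding Fw xs by (simp add: power2_eq_square)
  then have "energy n F x = (\<Sum>i\<in>{1..n}. profile (x i)) + (6 * u * q\<^sup>2)"
    by (simp add: energy_def)
  then have "energy n (star 8) y < energy n F x"
    using gain(3) Ey P by linarith
  moreover have "card F = card (star 8)"
    using cardF by (simp add: card_star)
  ultimately show False
    using optimal_le[OF opt star_subset _ yw, of 8] n by simp
qed

section \<open>Sorted and shifted optimal pairs\<close>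

definition shifted :: "nat set set \<Rightarrow> bool" where
  "shifted F \<longleftrightarrow> (\<forall>e\<in>F. \<forall>i\<in>e. \<forall>j. 1 \<le> j \<and> j < i \<and> j \<notin> e \<longrightarrow> insert j (e - {i}) \<in> F)"

lemma shiftedD:
  assumes "shifted F" "e \<in> F" "i \<in> e" "1 \<le> j" "j < i" "j \<notin> e"
  shows "insert j (e - {i}) \<in> F"
  using assms unfolding shifted_def by blast

lemma shifted_down:
  assumes F: "shifted F" and e: "{a, b, c} \<in> F" and abc: "a < b" "b < c"
    and le: "a' \<le> a" "b' \<le> b" "c' \<le> c" and abc': "1 \<le> a'" "a' < b'" "b' < c'"
  shows "{a', b', c'} \<in> F"
proof -
  have 1: "{a', b, c} \<in> F"
  proof (cases "a' = a")
    case False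
    then have "insert a' ({a, b, c} - {a}) \<in> F"
      using le abc abc' by (intro shiftedD[OF F e]) auto
    moreover have "insert a' ({a, b, c} - {a}) = {a', b, c}"
      using abc by auto
    ultimately show ?thesis by simp
  qed (use e in simp)
  have 2: "{a', b', c} \<in> F"
  proof (cases "b' = b")
    case False
    then have "insert b' ({a', b, c} - {b}) \<in> F"
      using le abc abc' by (intro shiftedD[OF F 1]) auto
    moreover have "insert b' ({a', b, c} - {b}) = {a', b', c}"
      using abc abc' le by auto
    ultimately show ?thesis by simp
  qed (use 1 in simp)
  show ?thesis
  proof (cases "c' = c")
    case False
    then have "insert c' ({a', b', c} - {c}) \<in> F"
      using le abc abc' by (intro shiftedD[OF F 2]) auto
    moreover have "insert c' ({a', b', c} - {c}) = {a', b', c'}"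
      using abc abc' le by auto
    ultimately show ?thesis by simp
  qed (use 2 in simp)
qed

lemma sorting_bijection:
  fixes x :: "nat \<Rightarrow> real"
  shows "\<exists>f. bij_betw f {1..n} {1..n} \<and> (\<forall>i j. 1 \<le> i \<longrightarrow> i \<le> j \<longrightarrow> j \<le> n \<longrightarrow> x (f i) \<le> x (f j))"
proof -
  define xs where "xs = sort_key x [1..<Suc n]"
  have xs: "distinct xs" "set xs = {1..n}" "length xs = n" "sorted (map x xs)"
    unfolding xs_def by auto
  have "bij_betw ((!) xs) {..<n} {1..n}"
    using bij_betw_nth[of xs "{..<n}" "{1..n}"] xs by simp
  moreover have "bij_betw (\<lambda>i. i - 1) {1..n} {..<n}"
    by (rule bij_betw_byWitness[where f' = Suc]) auto
  ultimately have "bij_betw ((!) xs \<circ> (\<lambda>i. i - 1)) {1..n} {1..n}"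
    by (rule bij_betw_trans[rotated])
  moreover have "x (((!) xs \<circ> (\<lambda>i. i - 1)) i) \<le> x (((!) xs \<circ> (\<lambda>i. i - 1)) j)"
    if "1 \<le> i" "i \<le> j" "j \<le> n" for i j
    using sorted_nth_mono[OF xs(4), of "i - 1" "j - 1"] xs(3) that by simp
  ultimately show ?thesis
    by blast
qed

lemma optimal_exists:
  assumes "0 < n" "a \<le> n choose 3"
  shows "\<exists>F x. optimal n F x \<and> card F = a"
proof -
  define S where "S = {F. F \<subseteq> triples_of {1..n} \<and> card F = a}"
  have fin: "finite (triples_of {1..n})"
    by (rule finite_triples_of) simp
  have "\<exists>x. x \<in> weightings n \<and> (\<forall>y\<in>weightings n. energy n F x \<le> energy n F y)" if "F \<in> S" for F
  proof -
    have F: "F \<subseteq> triples_of {1..n}" using that by (simp add: S_def)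
    have "three_graph n (triples_of {1..n} - F)"
      by (auto simp: three_graph_def triples_of_def)
    from lagrangian_attained[OF this assms(1)] obtain x where x: "x \<in> weightings n"
      "\<forall>y\<in>weightings n. edge_weight (triples_of {1..n} - F) y \<le> edge_weight (triples_of {1..n} - F) x"
      by blast
    have "energy n F x \<le> energy n F y" if y: "y \<in> weightings n" for y
    proof -
      have "edge_weight (triples_of {1..n} - F) y \<le> edge_weight (triples_of {1..n} - F) x"
        using x(2) y by blast
      then show ?thesis
        unfolding edge_weight_complement[OF F y] edge_weight_complement[OF F x(1)] by linarith
    qed
    then show ?thesis using x(1) by blast
  qed
  then have "\<forall>F\<in>S. \<exists>x. x \<in> weightings n \<and> (\<forall>y\<in>weightings n. energy n F x \<le> energy n F y)"
    by (intro ballI)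
  from bchoice[OF this] obtain w where
    "\<forall>F\<in>S. w F \<in> weightings n \<and> (\<forall>y\<in>weightings n. energy n F (w F) \<le> energy n F y)"
    by (rule exE)
  then have w: "w F \<in> weightings n" "y \<in> weightings n \<Longrightarrow> energy n F (w F) \<le> energy n F y"
    if "F \<in> S" for F y
    using that by simp_all
  have "finite S"
    unfolding S_def by (rule finite_subset[of _ "Pow (triples_of {1..n})"]) (blast, simp only: finite_Pow_iff fin)
  moreover have "a \<le> card (triples_of {1..n})"
    using assms(2) by (simp add: card_triples_of)
  then obtain F where "F \<subseteq> triples_of {1..n}" "card F = a"
    by (rule obtain_subset_with_card_n)
  then have "F \<in> S"
    by (simp add: S_def)
  then have "S \<noteq> {}"
    by blast
  ultimately obtain F where F: "F \<in> S" "\<forall>G\<in>S. energy n F (w F) \<le> energy n G (w G)"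
    using ex_is_arg_min_if_finite[of S "\<lambda>F. energy n F (w F)"]
    unfolding is_arg_min_def by (meson linorder_not_less)
  have "optimal n F (w F)"
    unfolding optimal_def
  proof (intro conjI allI impI)
    show "F \<subseteq> triples_of {1..n}" "w F \<in> weightings n"
      using F(1) w(1)[OF F(1)] by (simp_all add: S_def)
    fix G y assume G: "G \<subseteq> triples_of {1..n}" "card G = card F" "y \<in> weightings n"
    then have "G \<in> S" using F(1) by (simp add: S_def)
    then show "energy n F (w F) \<le> energy n G y"
      using F(2) w(2)[OF \<open>G \<in> S\<close> G(3)] order_trans by blast
  qed
  then show ?thesis
    using F(1) by (auto simp: S_def)
qed

lemma energy_relabel:
  assumes f: "bij_betw f {1..n} {1..n}" and F: "F \<subseteq> triples_of {1..n}"
  shows "energy n ((`) f ` F) x = energy n F (x \<circ> f)"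
proof -
  have "edge_weight ((`) f ` F) x = edge_weight F (x \<circ> f)"
    using f F by (intro edge_weight_image) (auto simp: bij_betw_def)
  moreover have "(\<Sum>i\<in>{1..n}. profile (x i)) = (\<Sum>i\<in>{1..n}. profile ((x \<circ> f) i))"
    using sum.reindex_bij_betw[OF f, of "\<lambda>i. profile (x i)"] by simp
  ultimately show ?thesis
    by (simp add: energy_def)
qed

lemma weightings_relabel:
  assumes f: "bij_betw f {1..n} {1..n}" and x: "x \<in> weightings n"
  shows "x \<circ> f \<in> weightings n"
proof -
  have "(\<Sum>i\<in>{1..n}. (x \<circ> f) i) = (\<Sum>i\<in>{1..n}. x i)"
    using sum.reindex_bij_betw[OF f, of x] by simp
  moreover have "0 \<le> (x \<circ> f) i" if "i \<in> {1..n}" for i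
    using x bij_betw_apply[OF f that] by (simp add: weightings_def)
  ultimately show ?thesis
    using x by (simp add: weightings_def)
qed

lemma card_relabel:
  assumes f: "bij_betw f {1..n} {1..n}" and F: "F \<subseteq> triples_of {1..n}"
  shows "card ((`) f ` F) = card F"
proof (rule card_image, rule inj_onI)
  fix d e assume "d \<in> F" "e \<in> F" "f ` d = f ` e"
  moreover from this have "d \<subseteq> {1..n}" "e \<subseteq> {1..n}"
    using F by (auto simp: triples_of_def)
  ultimately show "d = e"
    using f inj_on_image_eq_iff[of f "{1..n}" d e] by (auto simp: bij_betw_def)
qed

text \<open>Permuting the vertices changes neither the energy nor optimality, so the weights may be sorted.\<close>

lemma optimal_sorted_exists:
  assumes "0 < n" "a \<le> n choose 3"
  shows "\<exists>F x. optimal n F x \<and> card F = a \<and> (\<forall>i j. 1 \<le> i \<longrightarrow> i \<le> j \<longrightarrow> j \<le> n \<longrightarrow> x i \<le> x j)"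
proof -
  obtain F x where opt: "optimal n F x" and a: "card F = a"
    using optimal_exists[OF assms] by blast
  obtain f where f: "bij_betw f {1..n} {1..n}"
    and mono: "\<forall>i j. 1 \<le> i \<longrightarrow> i \<le> j \<longrightarrow> j \<le> n \<longrightarrow> x (f i) \<le> x (f j)"
    using sorting_bijection by blast
  define g where "g = inv_into {1..n} f"
  have g: "bij_betw g {1..n} {1..n}"
    unfolding g_def by (rule bij_betw_inv_into[OF f])
  have FV: "F \<subseteq> triples_of {1..n}" and xw: "x \<in> weightings n"
    using opt by (auto simp: optimal_def)
  define G where "G = (`) g ` F"
  have GV: "G \<subseteq> triples_of {1..n}"
    unfolding G_def using image_triples_of[OF g] FV by blast
  have card: "card G = card F"
    unfolding G_def by (rule card_relabel[OF g FV])
  have "energy n G (x \<circ> f) = energy n F (x \<circ> f \<circ> g)"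
    unfolding G_def by (rule energy_relabel[OF g FV])
  also have "\<dots> = energy n F x"
  proof -
    have fg: "(x \<circ> f \<circ> g) i = x i" if "i \<in> {1..n}" for i
      using bij_betw_inv_into_right[OF f that] by (simp add: g_def)
    have "edge_weight F (x \<circ> f \<circ> g) = edge_weight F x"
    proof (rule edge_weight_cong, rule fg)
      show "i \<in> {1..n}" if "e \<in> F" "i \<in> e" for e i
        using that FV unfolding triples_of_def by blast
    qed
    moreover have "(\<Sum>i\<in>{1..n}. profile ((x \<circ> f \<circ> g) i)) = (\<Sum>i\<in>{1..n}. profile (x i))"
      by (intro sum.cong refl arg_cong[of _ _ profile] fg)
    ultimately show ?thesis
      unfolding energy_def by simp
  qed
  finally have "energy n G (x \<circ> f) = energy n F x" .
  then have "optimal n G (x \<circ> f)"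
    using opt GV weightings_relabel[OF f xw] card unfolding optimal_def by simp
  moreover have "card G = a"
    using card a by simp
  moreover have "\<forall>i j. 1 \<le> i \<longrightarrow> i \<le> j \<longrightarrow> j \<le> n \<longrightarrow> (x \<circ> f) i \<le> (x \<circ> f) j"
    using mono unfolding comp_apply .
  ultimately show ?thesis
    by (intro exI[of _ G] exI[of _ "x \<circ> f"] conjI)
qed

text \<open>For fixed increasing weights choose among the optimal sets of missing triples one with the least sum of
labels. Replacing a vertex of a missing triple by a smaller, hence lighter, one does not increase the energy
but decreases this sum, so the triple obtained must already be missing.\<close>

lemma optimal_shifted_exists:
  assumes "0 < n" "a \<le> n choose 3"
  shows "\<exists>F x. optimal n F x \<and> card F = a \<and> shifted F \<and>
    (\<forall>i j. 1 \<le> i \<longrightarrow> i \<le> j \<longrightarrow> j \<le> n \<longrightarrow> x i \<le> x j)"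
proof -
  obtain F0 x where opt0: "optimal n F0 x" and a0: "card F0 = a"
    and mono: "\<forall>i j. 1 \<le> i \<longrightarrow> i \<le> j \<longrightarrow> j \<le> n \<longrightarrow> x i \<le> x j"
    using optimal_sorted_exists[OF assms] by blast
  define label_sum where "label_sum = (\<lambda>F :: nat set set. \<Sum>e\<in>F. \<Sum>e)"
  have "\<exists>F. (optimal n F x \<and> card F = a) \<and>
      (\<forall>G. (optimal n G x \<and> card G = a) \<longrightarrow> label_sum F \<le> label_sum G)"
    using opt0 a0 by (intro ex_has_least_nat[of _ F0]) simp
  then obtain F where opt: "optimal n F x" and a: "card F = a"
    and least: "\<And>G. optimal n G x \<Longrightarrow> card G = a \<Longrightarrow> label_sum F \<le> label_sum G"
    by blast
  have FV: "F \<subseteq> triples_of {1..n}" and xw: "x \<in> weightings n"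
    using opt by (auto simp: optimal_def)
  note fin = finite_triples_on[OF FV]
  have "shifted F"
    unfolding shifted_def
  proof (intro ballI allI impI, elim conjE, rule ccontr)
    fix e i j assume e: "e \<in> F" "i \<in> e" "1 \<le> j" "j < i" "j \<notin> e"
      and notin: "insert j (e - {i}) \<notin> F"
    let ?e = "insert j (e - {i})" and ?d = "e - {i}"
    let ?G = "insert ?e (F - {e})"
    have fe: "finite e" and eV: "e \<subseteq> {1..n}" and c3: "card e = 3"
      using e(1) FV fin by (auto simp: triples_of_def)
    have i: "i \<in> {1..n}" using e(2) eV by blast
    have "?e \<in> triples_of {1..n}"
      using fe eV c3 e i by (auto simp: triples_of_def)
    then have GV: "?G \<subseteq> triples_of {1..n}"
      using FV by blast
    have jd: "j \<notin> ?d" and id: "i \<notin> ?d" and fd: "finite ?d" and ee: "e = insert i ?d"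
      using e fe by auto
    have "(\<Prod>l\<in>?e. x l) = x j * (\<Prod>l\<in>?d. x l)"
      by (rule prod.insert[OF fd jd])
    moreover have "(\<Prod>l\<in>e. x l) = x i * (\<Prod>l\<in>?d. x l)"
      by (rule prod.remove[OF fe e(2)])
    moreover have "0 \<le> (\<Prod>l\<in>?d. x l)"
      using eV xw by (intro prod_nonneg) (auto simp: weightings_def)
    moreover have "x j \<le> x i"
      using mono e i by auto
    ultimately have le: "(\<Prod>l\<in>?e. x l) \<le> (\<Prod>l\<in>e. x l)"
      by (simp add: mult_right_mono)
    have cG: "card ?G = card F"
      by (rule edge_weight_swap(2)[OF fin(1) e(1) notin])
    have "energy n ?G x \<le> energy n F x"
      unfolding energy_def edge_weight_swap(1)[OF fin(1) e(1) notin] using le by simp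
    then have "optimal n ?G x"
      using opt GV cG unfolding optimal_def by (metis order_trans)
    then have "label_sum F \<le> label_sum ?G"
      using trans[OF cG a] by (rule least)
    moreover have "label_sum ?G = \<Sum>?e + label_sum (F - {e})"
      unfolding label_sum_def using fin notin by (subst sum.insert) auto
    moreover have "label_sum F = \<Sum>e + label_sum (F - {e})"
      unfolding label_sum_def by (rule sum.remove[OF fin(1) e(1)])
    moreover have "\<Sum>?e = j + \<Sum>?d"
      by (rule sum.insert[OF fd jd])
    moreover have "\<Sum>e = i + \<Sum>?d"
      by (rule sum.remove[OF fe e(2)])
    ultimately show False
      using e(4) by linarith
  qed
  then show ?thesis
    using opt a mono by blast
qed

section \<open>Stars are optimal\<close>

lemma initial_segment:
  fixes N :: "nat set"
  assumes "finite N" "c \<in> N" "\<And>i. i \<in> N \<Longrightarrow> c \<le> i" "\<And>i j. i \<in> N \<Longrightarrow> c \<le> j \<Longrightarrow> j \<le> i \<Longrightarrow> j \<in> N"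
  shows "\<exists>m\<ge>c. N = {c..m}"
proof (intro exI conjI)
  show "c \<le> Max N"
    using assms(1,2) by (rule Max_ge)
  show "N = {c..Max N}"
  proof (intro equalityI subsetI)
    fix i assume "i \<in> N"
    then show "i \<in> {c..Max N}"
      using assms(1,3) by simp
  next
    fix i assume "i \<in> {c..Max N}"
    moreover have "Max N \<in> N"
      using assms(1,2) by (intro Max_in) auto
    ultimately show "i \<in> N"
      using assms(4) by simp
  qed
qed

lemma initial_segment_of_shifted:
  assumes sh: "shifted F" and FV: "F \<subseteq> triples_of {1..n}"
    and c: "1 \<le> a" "a < b" "b < c" "{a, b, c} \<in> F"
  shows "\<exists>m\<ge>c. \<forall>i\<ge>c. {a, b, i} \<in> F \<longleftrightarrow> i \<le> m"
proof -
  define N where "N = {i. c \<le> i \<and> {a, b, i} \<in> F}"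
  have N: "i \<in> N \<longleftrightarrow> c \<le> i \<and> {a, b, i} \<in> F" for i
    by (simp add: N_def)
  have "\<exists>m\<ge>c. N = {c..m}"
  proof (rule initial_segment)
    have "i \<le> n" if "i \<in> N" for i
    proof -
      have "{a, b, i} \<in> triples_of {1..n}"
        using that by (intro subsetD[OF FV]) (simp add: N)
      then show ?thesis by (simp add: triples_of_def)
    qed
    then have "N \<subseteq> {..n}"
      unfolding subset_iff by simp
    then show "finite N"
      by (rule finite_subset) simp
    show "c \<in> N" using c(4) by (simp add: N)
    show "c \<le> i" if "i \<in> N" for i using that by (simp add: N)
    show "j \<in> N" if "i \<in> N" "c \<le> j" "j \<le> i" for i j
    proof -
      have "{a, b, i} \<in> F" "b < i" "b < j"
        using that c(3) by (simp_all add: N)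
      then have "{a, b, j} \<in> F"
        using shifted_down[OF sh, of a b i a b j] that(3) c(1,2) by simp
      then show ?thesis using that(2) by (simp add: N)
    qed
  qed
  then obtain m where m: "c \<le> m" "N = {c..m}"
    by blast
  have "{a, b, i} \<in> F \<longleftrightarrow> i \<le> m" if "c \<le> i" for i
    using N[of i] that unfolding m(2) by simp
  then show ?thesis
    using m(1) by blast
qed

lemma filter_insert:
  "{e \<in> insert d A. P e} = (if P d then insert d {e \<in> A. P e} else {e \<in> A. P e})"
  by auto

lemma sorted_edge_cases:
  assumes "e \<in> F" "F \<subseteq> triples_of {1..n}"
  obtains a b c where "e = {a, b, c}" "1 \<le> a" "a < b" "b < c" "c \<le> n"
proof -
  have "e \<in> triples_of {1..n}"
    using assms by (rule subsetD[rotated])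
  then obtain a b c where "e = {a, b, c} \<and> a < b \<and> b < c \<and> a \<in> {1..n} \<and> b \<in> {1..n} \<and> c \<in> {1..n}"
    unfolding in_triples_of_iff by (elim exE)
  then show ?thesis
    by (intro that[of a b c]) simp_all
qed

text \<open>If some missing triple does not contain both 1 and 2, then \<open>{1,3,4}\<close> is missing as well. Suppose first that
\<open>{2,3,4}\<close> is missing. If \<open>{1,3,5}\<close> is missing too, then six triples are known and vertex 5 lies in exactly two of
them; otherwise every triple that contains a vertex above 4 also contains 1 and 2, and \<open>F\<close> is a star plus two triples.
Suppose next that \<open>{2,3,4}\<close> is an edge, so that all missing triples contain 1. If \<open>{1,4,5}\<close> is missing, the six
triples in the link of 1 are known; otherwise all missing triples contain \<open>{1,2}\<close> or \<open>{1,3}\<close>, and the largest \<open>j\<close> with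
\<open>{1,3,j}\<close> missing lies in exactly two of them.\<close>

lemma optimal_shifted_is_star:
  assumes opt: "optimal n F x" and pos: "\<forall>i\<in>{1..n}. 0 < x i"
    and ord: "\<And>i j. 1 \<le> i \<Longrightarrow> i \<le> j \<Longrightarrow> j \<le> n \<Longrightarrow> x i \<le> x j"
    and sh: "shifted F" and n: "card F + 2 \<le> n" and a6: "card F \<le> 6"
  shows "F = star (card F + 2)"
proof (cases "F = {}")
  case True
  then show ?thesis by (simp add: star_def)
next
  case False
  have FV: "F \<subseteq> triples_of {1..n}"
    using opt by (simp add: optimal_def)
  note fin = finite_triples_on(1)[OF FV]
  have down: "{a', b', c'} \<in> F" if "{a, b, c} \<in> F" "a < b" "b < c" "a' \<le> a" "b' \<le> b" "c' \<le> c"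
      "1 \<le> a'" "a' < b'" "b' < c'" for a b c a' b' c'
    using shifted_down[OF sh that] .
  have f123: "{1, 2, 3} \<in> F"
  proof -
    obtain e where e: "e \<in> F" using False by blast
    obtain a b c where "e = {a, b, c}" "1 \<le> a" "a < b" "b < c" "c \<le> n"
      using e FV by (rule sorted_edge_cases)
    then show ?thesis
      using down[of a b c 1 2 3] e by simp
  qed
  have "\<exists>m\<ge>3. \<forall>i\<ge>3. {1, 2, i} \<in> F \<longleftrightarrow> i \<le> m"
    by (rule initial_segment_of_shifted[OF sh FV _ _ _ f123]) simp_all
  then obtain m where m: "3 \<le> m" "\<And>i. 3 \<le> i \<Longrightarrow> {1, 2, i} \<in> F \<longleftrightarrow> i \<le> m"
    by blast
  have starF: "star m \<subseteq> F"
    using m by (auto simp: star_def)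
  have in_star: "{1, 2, c} \<in> star m" if "{1, 2, c} \<in> F" "2 < c" for c
    using that m(2)[of c] by (simp add: star_def)
  show ?thesis
  proof (cases "\<forall>e\<in>F. 1 \<in> e \<and> 2 \<in> e")
    case True
    have "F \<subseteq> star m"
    proof
      fix e assume e: "e \<in> F"
      obtain a b c where abc: "e = {a, b, c}" "1 \<le> a" "a < b" "b < c" "c \<le> n"
        using e FV by (rule sorted_edge_cases)
      have "1 \<in> e" "2 \<in> e" using True e by blast+
      have a: "a = 1" using \<open>1 \<in> e\<close> abc by auto
      have b: "b = 2" using \<open>2 \<in> e\<close> abc a by auto
      show "e \<in> star m"
        using in_star[of c] e abc(4) unfolding abc(1) a b by simp
    qed
    then have "F = star m" using starF by blast
    moreover have "card (star m) + 2 = m"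
      using m(1) by (simp add: card_star)
    ultimately show ?thesis by simp
  next
    case False
    then obtain e where e: "e \<in> F" "\<not> (1 \<in> e \<and> 2 \<in> e)" by blast
    obtain a b c where abc: "e = {a, b, c}" "1 \<le> a" "a < b" "b < c" "c \<le> n"
      using e(1) FV by (rule sorted_edge_cases)
    have b3: "3 \<le> b"
    proof (rule ccontr)
      assume "\<not> 3 \<le> b"
      then have "a = 1" "b = 2" using abc(2,3) by simp_all
      then show False using e(2) abc(1) by simp
    qed
    have f134: "{1, 3, 4} \<in> F"
      using down[of a b c 1 3 4] e(1) abc b3 by simp
    have f124: "{1, 2, 4} \<in> F"
      using down[of 1 3 4 1 2 4] f134 by simp
    have m4: "4 \<le> m"
      using m(2)[of 4] f124 by simp
    have big: "card A \<le> card F" if "A \<subseteq> F" for A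
      using that fin by (rule card_mono[rotated])
    have swap_case: False if "4 \<le> j" "j < k" "k \<le> n"
        and Fj: "{e\<in>F. j \<in> e} = {{1, 2, j}, {1, 3, j}}" and Fk: "{e\<in>F. k \<in> e} = {}" for j k
    proof (rule optimal_no_twin_edges[OF opt pos _ _ _ Fj Fk])
      show "distinct [1, 2, 3, j, k]" "{1, 2, 3, j, k} \<subseteq> {1..n}"
        using that(1-3) by auto
      show "{1, 2, 3} \<in> F" by (rule f123)
      show "x 1 \<le> x 2" "x 2 \<le> x 3" "x 3 \<le> x j" "x j \<le> x k"
        using that(1-3) by (auto intro!: ord)
    qed
    have six_case: False if "A \<subseteq> F" "card A = 6" "A = {{1, 2, 3}, {1, 2, 4}, {1, 2, 5}, {1, 3, 4}, {1, 3, 5}, {1, 4, 5}}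
        \<or> A = {{1, 2, 3}, {1, 2, 4}, {1, 2, 5}, {1, 3, 4}, {1, 3, 5}, {2, 3, 4}}" for A
    proof -
      have FA: "F = A"
        using card_subset_eq[OF fin that(1)] big[OF that(1)] a6 that(2) by simp
      have n8: "8 \<le> n"
        using n FA that(2) by simp
      from that(3) show False
      proof
        assume "A = {{1, 2, 3}, {1, 2, 4}, {1, 2, 5}, {1, 3, 4}, {1, 3, 5}, {1, 4, 5}}"
        then show False
          using optimal_not_link_clique[OF opt pos ord _ n8] FA by simp
      next
        assume A: "A = {{1, 2, 3}, {1, 2, 4}, {1, 2, 5}, {1, 3, 4}, {1, 3, 5}, {2, 3, 4}}"
        show False
        proof (rule swap_case[of 5 6])
          show "{e \<in> F. 5 \<in> e} = {{1, 2, 5}, {1, 3, 5}}"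
            unfolding FA A filter_insert by simp
          show "{e \<in> F. 6 \<in> e} = {}"
            unfolding FA A filter_insert by simp
        qed (use n8 in simp_all)
      qed
    qed
    have False
    proof (cases "{2, 3, 4} \<in> F")
      case f234: True
      show False
      proof (cases "{1, 3, 5} \<in> F")
        case f135: True
        have f125: "{1, 2, 5} \<in> F"
          using down[of 1 3 5 1 2 5] f135 by simp
        have "distinct [{1, 2, 3}, {1, 2, 4}, {1, 2, 5}, {1, 3, 4}, {1, 3, 5}, {2, 3, 4::nat}]"
          by (simp add: set_eq_subset)
        from distinct_card[OF this]
        have "card {{1, 2, 3}, {1, 2, 4}, {1, 2, 5}, {1, 3, 4}, {1, 3, 5}, {2, 3, 4::nat}} = 6"
          by (simp only: list.set list.size)
        then show False
          using f123 f124 f125 f134 f135 f234 by (intro six_case[OF _ _ disjI2[OF refl]]) simp_all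
      next
        case n135: False
        have F: "F = star m \<union> {{1, 3, 4}, {2, 3, 4}}"
        proof (intro equalityI subsetI)
          fix e assume e: "e \<in> F"
          obtain a b c where abc: "e = {a, b, c}" "1 \<le> a" "a < b" "b < c" "c \<le> n"
            using e FV by (rule sorted_edge_cases)
          show "e \<in> star m \<union> {{1, 3, 4}, {2, 3, 4}}"
          proof (cases "b = 2")
            case True
            then have a: "a = 1" using abc(2,3) by simp
            show ?thesis
              using in_star[of c] e abc(4) unfolding abc(1) a True by simp
          next
            case False
            then have "3 \<le> b" using abc(2,3) by simp
            have "c < 5"
            proof (rule ccontr)
              assume "\<not> c < 5"
              then have "{1, 3, 5} \<in> F"
                using down[of a b c 1 3 5] e abc \<open>3 \<le> b\<close> by simp
              then show False using n135 by simp
            qed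
            then have bc: "b = 3" "c = 4" and "a = 1 \<or> a = 2"
              using abc(2-4) \<open>3 \<le> b\<close> by auto
            from this(3) show ?thesis
              unfolding abc(1) bc by (rule disjE) simp_all
          qed
        next
          fix e assume "e \<in> star m \<union> {{1, 3, 4}, {2, 3, 4}}"
          then show "e \<in> F" using starF f134 f234 by blast
        qed
        have ne: "{1, 3, 4} \<noteq> {2, 3, 4::nat}"
          by auto
        have "card F = card (star m) + card {{1, 3, 4}, {2, 3, 4::nat}}"
          unfolding F by (rule card_Un_disjoint) (auto simp: star_def insert_eq_iff doubleton_eq_iff)
        then have "card F = m"
          using m4 ne by (simp add: card_star del: One_nat_def)
        then show False
          using optimal_not_clique_star[OF opt pos ord F m4] a6 n by simp
      qed
    next
      case n234: False
      have a1: "a = 1" if "{a, b, c} \<in> F" "1 \<le> a" "a < b" "b < c" for a b c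
      proof (rule ccontr)
        assume "a \<noteq> 1"
        then have "{2, 3, 4} \<in> F"
          using down[of a b c 2 3 4] that by simp
        then show False using n234 by simp
      qed
      show False
      proof (cases "{1, 4, 5} \<in> F")
        case f145: True
        have f135: "{1, 3, 5} \<in> F"
          using down[of 1 4 5 1 3 5] f145 by simp
        have f125: "{1, 2, 5} \<in> F"
          using down[of 1 4 5 1 2 5] f145 by simp
        have "distinct [{1, 2, 3}, {1, 2, 4}, {1, 2, 5}, {1, 3, 4}, {1, 3, 5}, {1, 4, 5::nat}]"
          by (simp add: set_eq_subset)
        from distinct_card[OF this]
        have "card {{1, 2, 3}, {1, 2, 4}, {1, 2, 5}, {1, 3, 4}, {1, 3, 5}, {1, 4, 5::nat}} = 6"
          by (simp only: list.set list.size)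
        then show False
          using f123 f124 f125 f134 f135 f145 by (intro six_case[OF _ _ disjI1[OF refl]]) simp_all
      next
        case n145: False
        have "\<exists>j\<ge>4. \<forall>i\<ge>4. {1, 3, i} \<in> F \<longleftrightarrow> i \<le> j"
          by (rule initial_segment_of_shifted[OF sh FV _ _ _ f134]) simp_all
        then obtain j where j: "4 \<le> j" "\<And>i. 4 \<le> i \<Longrightarrow> {1, 3, i} \<in> F \<longleftrightarrow> i \<le> j"
          by blast
        have jF: "{1, 3, j} \<in> F" "{1, 2, j} \<in> F"
        proof -
          show "{1, 3, j} \<in> F" using j by simp
          then show "{1, 2, j} \<in> F"
            using down[of 1 3 j 1 2 j] j(1) by simp
        qed
        then have jm: "j \<le> m"
          using m(2)[of j] j(1) by simp
        have shape: "(\<exists>i. 3 \<le> i \<and> i \<le> m \<and> e = {1, 2, i}) \<or> (\<exists>i. 4 \<le> i \<and> i \<le> j \<and> e = {1, 3, i})"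
          if e: "e \<in> F" for e
        proof -
          obtain a b c where abc: "e = {a, b, c}" "1 \<le> a" "a < b" "b < c" "c \<le> n"
            using e FV by (rule sorted_edge_cases)
          have a: "a = 1" using a1[of a b c] abc e by simp
          have "b < 4"
          proof (rule ccontr)
            assume "\<not> b < 4"
            then have "{1, 4, 5} \<in> F"
              using down[of a b c 1 4 5] e abc by simp
            then show False using n145 by simp
          qed
          then have "b = 2 \<or> b = 3" using abc(3) a by auto
          then show ?thesis
          proof
            assume "b = 2"
            then have "3 \<le> c" "e = {1, 2, c}" using abc(4) unfolding abc(1) a by simp_all
            moreover from this have "c \<le> m" using m(2)[of c] e by simp
            ultimately show ?thesis by blast
          next
            assume "b = 3"
            then have "4 \<le> c" "e = {1, 3, c}" using abc(4) unfolding abc(1) a by simp_all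
            moreover from this have "c \<le> j" using j(2)[of c] e by simp
            ultimately show ?thesis by blast
          qed
        qed
        have "insert {1, 3, 4} (star m) \<subseteq> F"
          using starF f134 by simp
        moreover have "{1, 3, 4} \<notin> star m"
          by (auto simp: star_def)
        moreover have "finite (star m)"
          by (simp add: star_def)
        ultimately have "Suc (card (star m)) \<le> card F"
          using big[of "insert {1, 3, 4} (star m)"] by simp
        then have mn: "m + 1 \<le> n"
          using n m4 by (simp add: card_star)
        show False
        proof (rule swap_case[of j "m + 1"])
          show "{e \<in> F. j \<in> e} = {{1, 2, j}, {1, 3, j}}"
          proof (intro equalityI subsetI)
            fix e assume "e \<in> {e \<in> F. j \<in> e}"
            then have "e \<in> F" "j \<in> e" by auto
            from shape[OF this(1)] this(2) j(1) show "e \<in> {{1, 2, j}, {1, 3, j}}"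
              by auto
          next
            fix e assume "e \<in> {{1, 2, j}, {1, 3, j}}"
            then show "e \<in> {e \<in> F. j \<in> e}" using jF by auto
          qed
          show "{e \<in> F. m + 1 \<in> e} = {}"
          proof (intro equals0I)
            fix e assume "e \<in> {e \<in> F. m + 1 \<in> e}"
            then have "e \<in> F" "m + 1 \<in> e" by auto
            from shape[OF this(1)] this(2) jm m4 show False by auto
          qed
        qed (use j jm mn in auto)
      qed
    qed
    then show ?thesis by simp
  qed
qed

text \<open>If the lightest weight is 0, the triples of the star weigh nothing at the same weighting; otherwise the previous
lemma applies.\<close>

lemma star_minimises_energy:
  assumes F: "F \<subseteq> triples_of {1..n}" and card: "card F + 2 \<le> n" "card F \<le> 6"
    and y: "y \<in> weightings n"
  shows "\<exists>z\<in>weightings n. energy n (star (card F + 2)) z \<le> energy n F y"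
proof -
  have "card F \<le> card (triples_of {1..n})"
    by (rule card_mono[OF _ F]) (rule finite_triples_of, simp)
  then have "card F \<le> n choose 3"
    by (simp add: card_triples_of)
  moreover have "0 < n"
    using card by simp
  ultimately obtain G x where opt: "optimal n G x" and a: "card G = card F" and sh: "shifted G"
    and ord: "\<forall>i j. 1 \<le> i \<longrightarrow> i \<le> j \<longrightarrow> j \<le> n \<longrightarrow> x i \<le> x j"
    using optimal_shifted_exists by blast
  have xw: "x \<in> weightings n" and GV: "G \<subseteq> triples_of {1..n}"
    using opt by (auto simp: optimal_def)
  have le: "energy n G x \<le> energy n F y"
    using optimal_le[OF opt F a[symmetric] y] .
  have "energy n (star (card F + 2)) x \<le> energy n G x"
  proof (cases "x 1 = 0")
    case True
    have "0 \<le> edge_weight G x"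
      unfolding edge_weight_def
    proof (intro sum_nonneg prod_nonneg)
      fix e i assume "e \<in> G" "i \<in> e"
      then have "i \<in> {1..n}" using GV unfolding triples_of_def by blast
      then show "0 \<le> x i" using xw by (simp add: weightings_def)
    qed
    then show ?thesis
      unfolding energy_def edge_weight_star using True by simp
  next
    case False
    have x1: "0 < x 1"
    proof -
      have "0 \<le> x 1" using xw \<open>0 < n\<close> by (simp add: weightings_def)
      then show ?thesis using False by simp
    qed
    have "\<forall>i\<in>{1..n}. 0 < x i"
    proof
      fix i assume "i \<in> {1..n}"
      then have "x 1 \<le> x i" using ord by simp
      then show "0 < x i" using x1 by simp
    qed
    then have "G = star (card G + 2)"
      using opt sh card a ord by (intro optimal_shifted_is_star) auto
    then show ?thesis
      unfolding a by simp
  qed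
  then show ?thesis
    using le xw by (meson order_trans)
qed

section \<open>Discarding the lightest vertex\<close>

text \<open>Discarding a smallest value never lowers the average, so \<open>h\<close> elements of at least average value remain.\<close>

lemma heavy_subset:
  fixes p :: "'a \<Rightarrow> real"
  assumes "finite A" "h \<le> card A" "\<And>a. a \<in> A \<Longrightarrow> 0 \<le> p a"
  shows "\<exists>H. H \<subseteq> A \<and> card H = h \<and> real h * (\<Sum>a\<in>A. p a) \<le> real (card A) * (\<Sum>a\<in>H. p a)"
  using assms
proof (induction "card A - h" arbitrary: A)
  case 0
  then show ?case by (intro exI[of _ A]) simp
next
  case (Suc d)
  have "A \<noteq> {}" using Suc.hyps(2) by auto
  have "\<exists>a\<in>A. \<forall>c\<in>A. p a \<le> p c"
    using ex_is_arg_min_if_finite[OF Suc.prems(1) \<open>A \<noteq> {}\<close>, of p]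
    unfolding is_arg_min_def by (meson linorder_not_less)
  then obtain a where a: "a \<in> A" "\<forall>c\<in>A. p a \<le> p c" by blast
  have cA: "card (A - {a}) = card A - 1"
    using Suc.prems(1) a(1) by simp
  have "\<exists>H. H \<subseteq> A - {a} \<and> card H = h \<and>
      real h * (\<Sum>c\<in>A - {a}. p c) \<le> real (card (A - {a})) * (\<Sum>c\<in>H. p c)"
    using Suc.hyps(2) Suc.prems a(1) cA by (intro Suc.hyps(1)) auto
  then obtain H where H: "H \<subseteq> A - {a}" "card H = h"
    "real h * (\<Sum>c\<in>A - {a}. p c) \<le> real (card (A - {a})) * (\<Sum>c\<in>H. p c)" by blast
  have sA: "(\<Sum>c\<in>A. p c) = p a + (\<Sum>c\<in>A - {a}. p c)"
    by (rule sum.remove[OF Suc.prems(1) a(1)])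
  have H0: "0 \<le> (\<Sum>c\<in>H. p c)"
    using H(1) Suc.prems(3) by (intro sum_nonneg) auto
  define N where "N = card (A - {a})"
  have N: "card A = Suc N"
    using card_Suc_Diff1[OF Suc.prems(1) a(1)] by (simp add: N_def)
  have "real N * p a \<le> (\<Sum>c\<in>A - {a}. p c)"
    using a unfolding N_def by (intro sum_bounded_below) auto
  then have "real h * (real N * p a) \<le> real h * (\<Sum>c\<in>A - {a}. p c)"
    by (intro mult_left_mono) auto
  also have "\<dots> \<le> real N * (\<Sum>c\<in>H. p c)"
    using H(3) by (simp add: N_def)
  finally have *: "real N * (real h * p a) \<le> real N * (\<Sum>c\<in>H. p c)"
    by (simp add: mult.left_commute)
  have "real h * p a \<le> (\<Sum>c\<in>H. p c)"
  proof (cases "N = 0")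
    case True
    then have "h = 0"
      using Suc.hyps(2) N by simp
    then show ?thesis using H0 by simp
  next
    case False
    then show ?thesis using * by (simp add: mult_le_cancel_left)
  qed
  then have "real h * (\<Sum>c\<in>A. p c) \<le> real (card A) * (\<Sum>c\<in>H. p c)"
    using H(3) unfolding sA N N_def[symmetric] by (simp add: algebra_simps)
  then show ?case
    using H(1,2) by blast
qed

text \<open>The balance of \<open>merge_lightest\<close>. Here \<open>b\<close> is the number of common neighbours of 1 and 2, \<open>l\<close> the degree of
vertex 1, \<open>N = n - 2\<close>, \<open>xn\<close> the largest weight, \<open>\<zeta>\<close> the weight of the links of 2 in the missing triples that avoid
1, and \<open>S\<close> the part of \<open>\<zeta>\<close> that belongs to the relocated triples. The last hypothesis comes from stationarity between
the vertices 2 and \<open>n\<close>; it bounds \<open>xn\<close> by \<open>x1 + x2\<close> plus a term that \<open>S\<close> pays for.\<close>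

lemma merge_gain:
  fixes x1 x2 xn b l R \<zeta> S N :: real
  assumes x: "0 \<le> x1" "x1 \<le> x2" and b: "0 \<le> b" "4 \<le> N" "b * N \<le> 2 * l" and S: "0 \<le> S" "b * \<zeta> \<le> N * S"
    and R: "N * x1 \<le> R" "(xn - x2) * R \<le> x1 * R + \<zeta>"
  shows "x1\<^sup>2 * (b * xn) \<le> l * (x2 * x1\<^sup>2) + x1 * S"
proof -
  define A where "A = xn - x1 - x2"
  have "4 * b \<le> b * N"
    using b(1,2) mult_left_mono[of 4 N b] by simp
  then have "2 * b \<le> l" using b(3) by simp
  then have "2 * b * (x2 * x1) \<le> l * (x2 * x1)"
    using x by (intro mult_right_mono mult_nonneg_nonneg) auto
  moreover have "b * x1 * (x1 + x2) \<le> 2 * b * (x2 * x1)"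
  proof -
    have "b * x1 * (x1 + x2) \<le> b * x1 * (x2 + x2)"
      using x b by (intro mult_left_mono mult_nonneg_nonneg) auto
    then show ?thesis by (simp add: algebra_simps)
  qed
  moreover have "b * x1 * A \<le> S"
  proof (cases "A \<le> 0")
    case True
    then have "b * x1 * A \<le> 0"
      using x b by (intro mult_nonneg_nonpos mult_nonneg_nonneg) auto
    then show ?thesis using S by simp
  next
    case False
    then have "N * x1 * A \<le> R * A"
      using R(1) by (intro mult_right_mono) auto
    also have "\<dots> \<le> \<zeta>"
      using R(2) unfolding A_def by (simp add: algebra_simps)
    finally have "b * (N * x1 * A) \<le> b * \<zeta>"
      using b(1) by (rule mult_left_mono)
    then have "N * (b * x1 * A) \<le> N * S"
      using S(2) by (simp add: mult_ac)
    then show ?thesis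
      using b(2) by (simp add: mult_le_cancel_left)
  qed
  ultimately have "b * x1 * xn \<le> l * (x2 * x1) + S"
    unfolding A_def by (simp add: algebra_simps)
  then have "x1 * (b * x1 * xn) \<le> x1 * (l * (x2 * x1) + S)"
    using x(1) by (rule mult_left_mono)
  then show ?thesis
    by (simp add: algebra_simps power2_eq_square)
qed

text \<open>Double counting. By shiftedness, if \<open>{1,2,i}\<close> is an edge, then so is \<open>{1,j,i}\<close> for every other \<open>j\<close>, so \<open>i\<close> lies
in \<open>n - 2\<close> edges at vertex 1, and each such edge is counted at most twice.\<close>

lemma light_vertex_degree:
  assumes sh: "shifted F" and n: "2 \<le> n"
  defines "B \<equiv> {i\<in>{3..n}. {1, 2, i} \<notin> F}"
  shows "card B * (n - 2) \<le> 2 * card {e \<in> triples_of {1..n} - F. 1 \<in> e}"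
proof -
  let ?E = "{e \<in> triples_of {1..n} - F. 1 \<in> e}"
  have finE: "finite ?E"
    by (rule finite_subset[OF _ finite_triples_of[of "{1..n}"]]) auto
  have finB: "finite B"
    by (simp add: B_def)
  have deg: "n - 2 \<le> card {e\<in>?E. i \<in> e}" if i: "i \<in> B" for i
  proof -
    have i3: "3 \<le> i" "i \<le> n" "{1, 2, i} \<notin> F"
      using i by (simp_all add: B_def)
    have "inj_on (\<lambda>j. {1, i, j}) ({2..n} - {i})"
    proof (rule inj_onI)
      fix j j' assume jj: "j \<in> {2..n} - {i}" "j' \<in> {2..n} - {i}" and eq: "{1, i, j} = {1, i, j'}"
      have "j \<in> {1, i, j'}" unfolding eq[symmetric] by simp
      then show "j = j'" using jj by simp
    qed
    then have "card ((\<lambda>j. {1, i, j}) ` ({2..n} - {i})) = card ({2..n} - {i})"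
      by (rule card_image)
    also have "\<dots> = n - 2"
      using i3 by simp
    finally have "n - 2 = card ((\<lambda>j. {1, i, j}) ` ({2..n} - {i}))" by simp
    also have "\<dots> \<le> card {e\<in>?E. i \<in> e}"
    proof (rule card_mono)
      show "finite {e\<in>?E. i \<in> e}" by (rule finite_subset[OF _ finE]) blast
      have "{1, i, j} \<in> {e\<in>?E. i \<in> e}" if j: "j \<in> {2..n} - {i}" for j
      proof -
        have "{1, i, j} \<notin> F"
        proof
          assume f: "{1, i, j} \<in> F"
          have "{1, 2, i} \<in> F"
          proof (cases "i < j")
            case True
            show ?thesis
              using shifted_down[OF sh f, of 1 2 i] True i3 by simp
          next
            case False
            then have "j < i" using j by simp
            moreover have "{1, j, i} \<in> F" using f by (simp add: insert_commute)
            ultimately show ?thesis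
              using shifted_down[OF sh, of 1 j i 1 2 i] j i3 by simp
          qed
          then show False using i3 by simp
        qed
        then show ?thesis
          using j i3 by (simp add: triples_of_def)
      qed
      then show "(\<lambda>j. {1, i, j}) ` ({2..n} - {i}) \<subseteq> {e\<in>?E. i \<in> e}"
        by (rule image_subsetI)
    qed
    finally show ?thesis .
  qed
  have "card B * (n - 2) \<le> (\<Sum>i\<in>B. card {e\<in>?E. i \<in> e})"
    using sum_bounded_below[of B "n - 2" "\<lambda>i. card {e\<in>?E. i \<in> e}"] deg by simp
  also have "\<dots> = (\<Sum>e\<in>?E. card {i\<in>B. i \<in> e})"
    by (rule sum_multicount_gen[OF finB finE]) simp
  also have "\<dots> \<le> (\<Sum>e\<in>?E. 2)"
  proof (rule sum_mono)
    fix e assume e: "e \<in> ?E"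
    then have c: "card e = 3" "1 \<in> e" by (simp_all add: triples_of_def)
    then have fe: "finite e" using card.infinite by fastforce
    have "{i\<in>B. i \<in> e} \<subseteq> e - {1}" by (auto simp: B_def)
    then have "card {i\<in>B. i \<in> e} \<le> card (e - {1})"
      using fe by (intro card_mono) auto
    also have "\<dots> = 2" using c fe by simp
    finally show "card {i\<in>B. i \<in> e} \<le> 2" .
  qed
  finally show ?thesis by (simp add: mult.commute)
qed

text \<open>The missing triples to which the edges at vertex 1 are relocated: as many as possible contain vertex 2, and these
carry a proportional share of the weight. At most \<open>(n - 2)\<^sup>2 / 2\<close> of the triples contain vertex 2, which together
with the lower bound on \<open>l\<close> gives the share \<open>b / (n - 2)\<close>.\<close>

lemma heavy_triples:
  assumes F: "F \<subseteq> triples_of {2..n}" and n: "2 \<le> n" and b: "b \<le> n - 2" "b * (n - 2) \<le> 2 * l"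
    and l: "l \<le> card F" and p: "\<And>e. e \<in> F \<Longrightarrow> 0 \<le> p e"
  shows "\<exists>D. D \<subseteq> F \<and> card D = l \<and>
    real b * (\<Sum>e\<in>{e\<in>F. 2 \<in> e}. p e) \<le> real (n - 2) * (\<Sum>e\<in>{e\<in>D. 2 \<in> e}. p e)"
proof -
  let ?A = "{e\<in>F. 2 \<in> e}"
  have finF: "finite F"
    by (rule finite_subset[OF F finite_triples_of]) simp
  have finA: "finite ?A"
    by (rule finite_subset[OF _ finF]) blast
  have cardA: "2 * card ?A \<le> (n - 2) * (n - 2)"
  proof -
    let ?P = "{d. d \<subseteq> {3..n} \<and> card d = 2}"
    have "inj_on (\<lambda>e. e - {2}) ?A"
    proof (rule inj_onI)
      fix d e assume "d \<in> ?A" "e \<in> ?A" "d - {2} = e - {2}"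
      then have "insert 2 (d - {2}) = insert 2 (e - {2})" "2 \<in> d" "2 \<in> e" by simp_all
      then show "d = e" by (simp add: insert_absorb)
    qed
    then have "card ?A = card ((\<lambda>e. e - {2}) ` ?A)"
      by (rule card_image[symmetric])
    also have "\<dots> \<le> card ?P"
    proof (rule card_mono)
      show "finite ?P" by (rule finite_subset[of _ "Pow {3..n}"]) (blast, simp)
      show "(\<lambda>e. e - {2}) ` ?A \<subseteq> ?P"
      proof (rule image_subsetI)
        fix e assume "e \<in> ?A"
        then have e: "e \<in> triples_of {2..n}" "2 \<in> e" using F by blast+
        have "card (e - {2}) = 2"
          using e finite_edge[OF e(1)] by (simp add: triples_of_def)
        moreover have "e - {2} \<subseteq> {3..n}"
        proof
          fix i assume i: "i \<in> e - {2}"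
          then have "i \<in> {2..n}" using e(1) unfolding triples_of_def by blast
          then show "i \<in> {3..n}" using i by simp
        qed
        ultimately show "e - {2} \<in> ?P" by simp
      qed
    qed
    also have "\<dots> = (n - 2) choose 2"
      using n_subsets[of "{3..n}" 2] by (simp add: Suc_diff_le numeral_eq_Suc)
    finally have "2 * card ?A \<le> 2 * ((n - 2) choose 2)" by simp
    also have "\<dots> \<le> (n - 2) * (n - 2 - 1)"
      unfolding choose_two by simp
    also have "\<dots> \<le> (n - 2) * (n - 2)"
      by (intro mult_le_mono2 diff_le_self)
    finally show ?thesis .
  qed
  define h where "h = min l (card ?A)"
  have pA: "0 \<le> p e" if "e \<in> ?A" for e
    using that p by blast
  have "\<exists>H. H \<subseteq> ?A \<and> card H = h \<and>
      real h * (\<Sum>e\<in>?A. p e) \<le> real (card ?A) * (\<Sum>e\<in>H. p e)"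
  proof (rule heavy_subset[OF finA])
    show "h \<le> card ?A" by (simp add: h_def)
  qed (rule pA)
  then obtain H where H: "H \<subseteq> ?A" "card H = h"
    "real h * (\<Sum>e\<in>?A. p e) \<le> real (card ?A) * (\<Sum>e\<in>H. p e)"
    by blast
  have finH: "finite H" by (rule finite_subset[OF H(1) finA])
  have S0: "0 \<le> (\<Sum>e\<in>?A. p e)" by (rule sum_nonneg) (rule pA)
  have H0: "0 \<le> (\<Sum>e\<in>H. p e)"
    by (rule sum_nonneg) (rule pA, rule subsetD[OF H(1)])
  have Hb: "real b * (\<Sum>e\<in>?A. p e) \<le> real (n - 2) * (\<Sum>e\<in>H. p e)"
  proof (cases "card ?A \<le> l")
    case True
    then have "card H = card ?A" using H(2) by (simp add: h_def)
    then have "H = ?A" by (rule card_subset_eq[OF finA H(1)])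
    then show ?thesis
      using b(1) S0 by (simp add: mult_right_mono)
  next
    case False
    then have hl: "h = l" by (simp add: h_def)
    have "0 < n - 2"
    proof (rule ccontr)
      assume "\<not> 0 < n - 2"
      then show False using cardA False by simp
    qed
    have "real (b * (n - 2)) * (\<Sum>e\<in>?A. p e) \<le> real (2 * l) * (\<Sum>e\<in>?A. p e)"
      using b(2) S0 by (intro mult_right_mono) (simp_all only: of_nat_le_iff)
    also have "\<dots> \<le> real (2 * card ?A) * (\<Sum>e\<in>H. p e)"
      using H(3) unfolding hl by simp
    also have "\<dots> \<le> real ((n - 2) * (n - 2)) * (\<Sum>e\<in>H. p e)"
      using cardA H0 by (intro mult_right_mono) (simp_all only: of_nat_le_iff)
    finally have "real (n - 2) * (real b * (\<Sum>e\<in>?A. p e)) \<le> real (n - 2) * (real (n - 2) * (\<Sum>e\<in>H. p e))"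
      by (simp add: mult_ac)
    then show ?thesis
      using \<open>0 < n - 2\<close> by (simp add: mult_le_cancel_left)
  qed
  have HF: "H \<subseteq> F" using H(1) by blast
  have "card (F - H) = card F - h"
    using card_Diff_subset[OF finH HF] H(2) by simp
  then have "l - h \<le> card (F - H)" using l by simp
  then obtain K where K: "K \<subseteq> F - H" "card K = l - h"
    by (rule obtain_subset_with_card_n) blast
  have finK: "finite K" using finite_subset[OF K(1)] finF by simp
  have Dl: "card (H \<union> K) = l"
    using card_Un_disjoint[OF finH finK] K H(2) by (auto simp: h_def)
  have DF: "H \<union> K \<subseteq> F"
    using HF K(1) by blast
  have "(\<Sum>e\<in>H. p e) \<le> (\<Sum>e\<in>{e\<in>H \<union> K. 2 \<in> e}. p e)"
  proof (rule sum_mono2)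
    show "finite {e\<in>H \<union> K. 2 \<in> e}" using finH finK by simp
    show "H \<subseteq> {e\<in>H \<union> K. 2 \<in> e}" using H(1) by blast
    show "0 \<le> p e" if "e \<in> {e\<in>H \<union> K. 2 \<in> e} - H" for e
      using that DF p by blast
  qed
  then have "real (n - 2) * (\<Sum>e\<in>H. p e) \<le> real (n - 2) * (\<Sum>e\<in>{e\<in>H \<union> K. 2 \<in> e}. p e)"
    by (rule mult_left_mono) simp
  from order_trans[OF Hb this] show ?thesis
    using DF Dl by blast
qed

text \<open>Moving the weight of 1 onto 2 has no first-order effect, by stationarity, and the second-order loss is \<open>(x 1)\<^sup>2\<close> times the
weight of the common neighbours \<open>B\<close>. The edges at 1 then weigh nothing and are exchanged for missing triples \<open>D\<close>.
The hypothesis on the number of edges ensures that enough missing triples avoid vertex 1.\<close>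

lemma merge_lightest:
  assumes opt: "optimal n F x" and pos: "\<forall>i\<in>{1..n}. 0 < x i"
    and ord: "\<And>i j. 1 \<le> i \<Longrightarrow> i \<le> j \<Longrightarrow> j \<le> n \<Longrightarrow> x i \<le> x j"
    and sh: "shifted F" and n: "6 \<le> n"
    and few: "card (triples_of {1..n} - F) \<le> (n - 1) choose 3"
  shows "\<exists>F' y. F' \<subseteq> triples_of {1..n} \<and> card F' = card F \<and> y \<in> weightings n \<and> y 1 = 0 \<and>
    energy n F' y \<le> energy n F x"
proof -
  have FV: "F \<subseteq> triples_of {1..n}" and xw: "x \<in> weightings n"
    using opt by (auto simp: optimal_def)
  note fin = finite_triples_on[OF FV]
  have finT: "finite (triples_of {1..n})" by (rule finite_triples_of) simp
  define E1 where "E1 = {e \<in> triples_of {1..n} - F. 1 \<in> e}"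
  define FT where "FT = {e \<in> F. 1 \<notin> e}"
  define B where "B = {i\<in>{3..n}. {1, 2, i} \<notin> F}"
  define b l where "b = card B" and "l = card E1"
  have finE1: "finite E1" by (rule finite_subset[OF _ finT]) (auto simp: E1_def)
  have finB: "finite B" by (simp add: B_def)
  have without1: "e \<in> triples_of {2..n} \<longleftrightarrow> e \<in> triples_of {1..n} \<and> 1 \<notin> e" for e
  proof -
    have "{2..n} = {1..n} - {1}" by auto
    then show ?thesis unfolding triples_of_def by auto
  qed
  have FT: "FT \<subseteq> triples_of {2..n}"
    using FV without1 unfolding FT_def by blast
  have bl: "b * (n - 2) \<le> 2 * l"
    unfolding b_def l_def B_def E1_def using n by (intro light_vertex_degree[OF sh]) simp
  have bn: "b \<le> n - 2"
  proof -
    have "b \<le> card {3..n}"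
      unfolding b_def B_def by (intro card_mono) auto
    then show ?thesis by simp
  qed
  have lF: "l \<le> card FT"
  proof -
    let ?R = "{e \<in> triples_of {1..n} - F. 1 \<notin> e}"
    have finR: "finite ?R" by (rule finite_subset[OF _ finT]) blast
    have "card (triples_of {1..n} - F) = card (E1 \<union> ?R)"
      by (rule arg_cong[of _ _ card]) (auto simp: E1_def)
    also have "\<dots> = l + card ?R"
      unfolding l_def using finE1 finR by (intro card_Un_disjoint) (auto simp: E1_def)
    finally have 1: "card (triples_of {1..n} - F) = l + card ?R" .
    have "(n - 1) choose 3 = card (triples_of {2..n})"
      by (simp add: card_triples_of)
    also have "triples_of {2..n} = FT \<union> ?R"
      using without1 FV unfolding FT_def by blast
    also have "card (FT \<union> ?R) = card FT + card ?R"
      using fin(1) finR unfolding FT_def by (intro card_Un_disjoint) auto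
    finally show ?thesis using few 1 by simp
  qed
  define p where "p = (\<lambda>e. \<Prod>i\<in>e - {2}. x i)"
  have x0: "0 \<le> x i" if "i \<in> {1..n}" for i
    using xw that by (simp add: weightings_def)
  have pnn: "0 \<le> p e" if "e \<in> F" for e
    unfolding p_def
  proof (rule prod_nonneg)
    fix i assume "i \<in> e - {2}"
    then have "i \<in> {1..n}" using that FV unfolding triples_of_def by blast
    then show "0 \<le> x i" by (rule x0)
  qed
  have "\<exists>D. D \<subseteq> FT \<and> card D = l \<and>
    real b * (\<Sum>e\<in>{e\<in>FT. 2 \<in> e}. p e) \<le> real (n - 2) * (\<Sum>e\<in>{e\<in>D. 2 \<in> e}. p e)"
  proof (rule heavy_triples[OF FT _ bn bl lF])
    show "2 \<le> n" using n by simp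
    show "0 \<le> p e" if "e \<in> FT" for e
      using that pnn unfolding FT_def by blast
  qed
  then obtain D where D: "D \<subseteq> FT" "card D = l"
    "real b * (\<Sum>e\<in>{e\<in>FT. 2 \<in> e}. p e) \<le> real (n - 2) * (\<Sum>e\<in>{e\<in>D. 2 \<in> e}. p e)"
    by blast
  have DF: "D \<subseteq> F" using D(1) unfolding FT_def by blast
  have finD: "finite D" by (rule finite_subset[OF DF fin(1)])
  define S where "S = (\<Sum>e\<in>{e\<in>D. 2 \<in> e}. p e)"
  define \<zeta> where "\<zeta> = (\<Sum>e\<in>{e\<in>FT. 2 \<in> e}. p e)"
  have S0: "0 \<le> S"
    unfolding S_def using DF pnn by (intro sum_nonneg) blast
  define y where "y = x(2 := x 2 + x 1, 1 := x 1 - x 1)"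
  have x12: "0 < x 1" "x 1 \<le> x 2"
    using pos ord[of 1 2] n by auto
  have yw: "y \<in> weightings n"
    unfolding y_def using xw n x12 by (intro weightings_move) auto
  have y: "y 1 = 0" "y 2 = x 2 + x 1" "\<And>i. 3 \<le> i \<Longrightarrow> y i = x i"
    by (auto simp: y_def)
  define F' where "F' = (F - D) \<union> E1"
  have F'V: "F' \<subseteq> triples_of {1..n}"
    using FV unfolding F'_def E1_def by blast
  have dis: "(F - D) \<inter> E1 = {}"
    unfolding E1_def by blast
  have "card F' = card (F - D) + card E1"
    unfolding F'_def using fin(1) finE1 dis by (intro card_Un_disjoint) auto
  moreover have "card (F - D) = card F - l"
    using card_Diff_subset[OF finD DF] D(2) by simp
  moreover have "l \<le> card F"
    using card_mono[OF fin(1) DF] D(2) by simp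
  ultimately have cF': "card F' = card F"
    by (simp add: l_def)
  have "(\<Sum>i\<in>{1..n}. x i) = 1" using xw by (simp add: weightings_def)
  moreover have "{1..n} = {1, 2} \<union> {3..n}" using n by auto
  moreover have "(\<Sum>i\<in>{1, 2} \<union> {3..n}. x i) = (\<Sum>i\<in>{1, 2}. x i) + (\<Sum>i\<in>{3..n}. x i)"
    by (intro sum.union_disjoint) auto
  ultimately have total: "x 1 + x 2 + (\<Sum>i\<in>{3..n}. x i) = 1" by simp
  have BV: "B \<subseteq> {3..n}" by (auto simp: B_def)
  have both: "{e\<in>F. 2 \<in> e \<and> 1 \<in> e} = (\<lambda>i. {1, 2, i}) ` ({3..n} - B)"
  proof (intro equalityI subsetI)
    fix e assume "e \<in> {e\<in>F. 2 \<in> e \<and> 1 \<in> e}"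
    then have e: "e \<in> F" "1 \<in> e" "2 \<in> e" by simp_all
    obtain a c d where acd: "e = {a, c, d}" "1 \<le> a" "a < c" "c < d" "d \<le> n"
      using e(1) FV by (rule sorted_edge_cases)
    have a: "a = 1" using e(2) acd by auto
    have c: "c = 2" using e(3) acd a by auto
    have "d \<in> {3..n} - B"
      using e(1) acd(4,5) unfolding acd(1) a c B_def by simp
    then show "e \<in> (\<lambda>i. {1, 2, i}) ` ({3..n} - B)"
      unfolding acd(1) a c by (rule imageI)
  next
    fix e assume "e \<in> (\<lambda>i. {1, 2, i}) ` ({3..n} - B)"
    then obtain i where "i \<in> {3..n} - B" "e = {1, 2, i}" by (rule imageE)
    then show "e \<in> {e\<in>F. 2 \<in> e \<and> 1 \<in> e}" by (simp add: B_def)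
  qed
  have inj: "inj_on (\<lambda>i. {1, 2, i}) ({3..n} - B)"
    by (rule inj_on_subset[OF inj_on_star]) blast
  have both_sum: "(\<Sum>e\<in>{e\<in>F. 2 \<in> e \<and> 1 \<in> e}. q e) = (\<Sum>i\<in>{3..n} - B. q {1, 2, i})"
    for q :: "nat set \<Rightarrow> real"
    unfolding both by (simp only: sum.reindex[OF inj] comp_def)
  have cod: "codegree_weight F 2 1 x = (\<Sum>i\<in>{3..n} - B. x i)"
    unfolding codegree_weight_def both_sum
  proof (rule sum.cong[OF refl])
    fix i assume "i \<in> {3..n} - B"
    then have "{1, 2, i} - {2, 1} = {i}" by auto
    then show "(\<Prod>l\<in>{1, 2, i} - {2, 1}. x l) = x i" by simp
  qed
  define CB where "CB = (\<Sum>i\<in>{3..n} - B. x i)"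
  have CB: "(\<Sum>i\<in>{3..n}. x i) = CB + (\<Sum>i\<in>B. x i)"
    unfolding CB_def using BV by (intro sum.subset_diff) auto
  have lin: "(x 2 - (x 2)\<^sup>2 + link_weight F 2 x) - (x 1 - (x 1)\<^sup>2 + link_weight F 1 x) = 0"
    using optimal_stationary[OF opt, of 2 1] n pos by (simp add: algebra_simps power2_eq_square)
  have "energy n F y = energy n F x + (x 1)\<^sup>2 * (1 - x 2 - x 1 - CB)"
    using energy_move[OF FV, of 2 1 x "x 1"] n unfolding y_def[symmetric] lin cod CB_def[symmetric] by simp
  moreover have "1 - x 2 - x 1 - CB = (\<Sum>i\<in>B. x i)"
    using total CB by linarith
  ultimately have Ey: "energy n F y = energy n F x + (x 1)\<^sup>2 * (\<Sum>i\<in>B. x i)"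
    by simp
  \<comment> \<open>Each relocated triple weighs at least \<open>x 2 * (x 1)\<^sup>2\<close>; one at vertex 2 profits in addition from the moved weight.\<close>
  have gainD: "real l * (x 2 * (x 1)\<^sup>2) + x 1 * S \<le> edge_weight D y"
  proof -
    have "(\<Sum>e\<in>D. x 2 * (x 1)\<^sup>2 + (if 2 \<in> e then x 1 * p e else 0)) \<le> edge_weight D y"
      unfolding edge_weight_def
    proof (rule sum_mono)
      fix e assume "e \<in> D"
      then have e: "e \<in> triples_of {2..n}" using D(1) FT by blast
      then obtain a c d where acd: "e = {a, c, d}" "a < c" "c < d" "a \<in> {2..n}" "d \<in> {2..n}"
        unfolding in_triples_of_iff by (elim exE conjE)
      have le: "x 1 \<le> x i" "x 2 \<le> x i" if "2 \<le> i" "i \<le> n" for i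
        using that ord[of 1 i] ord[of 2 i] by simp_all
      have nn: "0 \<le> x 1" "0 \<le> x 2" "0 \<le> x a" "0 \<le> x c" "0 \<le> x d"
        using acd(2-5) n by (auto intro!: x0)
      have cd: "x 1 * x 1 \<le> x c * x d"
        using acd(2-5) nn by (intro mult_mono le) auto
      show "x 2 * (x 1)\<^sup>2 + (if 2 \<in> e then x 1 * p e else 0) \<le> (\<Prod>i\<in>e. y i)"
      proof (cases "a = 2")
        case True
        have "e - {2} = {c, d}" using acd True by auto
        then have pe: "p e = x c * x d" unfolding p_def using acd by simp
        have "(\<Prod>i\<in>e. y i) = (x 2 + x 1) * (x c * x d)"
          unfolding acd(1) using acd(2-4) True y by simp
        moreover have "x 2 * (x 1 * x 1) \<le> x 2 * (x c * x d)"
          using cd x12 by (intro mult_left_mono) auto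
        moreover have "2 \<in> e" using acd(1) True by simp
        ultimately show ?thesis
          using pe by (simp add: algebra_simps power2_eq_square)
      next
        case False
        then have "2 \<notin> e" unfolding acd(1) using acd(2-5) by simp
        moreover have "(\<Prod>i\<in>e. y i) = x a * (x c * x d)"
          unfolding acd(1) using acd(2-5) False y by simp
        moreover have "x 2 * (x 1 * x 1) \<le> x a * (x c * x d)"
          using acd(2-5) cd nn by (intro mult_mono le) auto
        ultimately show ?thesis
          by (simp add: power2_eq_square)
      qed
    qed
    moreover have "(\<Sum>e\<in>D. if 2 \<in> e then x 1 * p e else 0) = x 1 * S"
      unfolding S_def sum_distrib_left using finD by (rule sum.inter_filter[symmetric])
    ultimately show ?thesis
      using D(2) by (simp add: sum.distrib)
  qed
  have loss: "(x 1)\<^sup>2 * (\<Sum>i\<in>B. x i) \<le> real l * (x 2 * (x 1)\<^sup>2) + x 1 * S"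
  proof (cases "B = {}")
    case True
    then show ?thesis
      using S0 x12 by simp
  next
    case False
    \<comment> \<open>As 1 and 2 have a common neighbour, shiftedness makes every triple at \<open>n\<close> an edge.\<close>
    have f12n: "{1, 2, n} \<notin> F"
    proof
      assume f: "{1, 2, n} \<in> F"
      obtain i where "i \<in> B" using False by blast
      then have "3 \<le> i" "i \<le> n" "{1, 2, i} \<notin> F" by (simp_all add: B_def)
      then show False
        using shifted_down[OF sh f, of 1 2 i] n by simp
    qed
    have "n \<notin> e" if e: "e \<in> F" for e
    proof
      assume ne: "n \<in> e"
      obtain a c d where acd: "e = {a, c, d}" "1 \<le> a" "a < c" "c < d" "d \<le> n"
        using e FV by (rule sorted_edge_cases)
      have d: "d = n" using ne acd by auto
      have "{1, 2, n} \<in> F"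
        using shifted_down[OF sh, of a c n 1 2 n] e acd(2-4) n unfolding acd(1) d by simp
      then show False using f12n by simp
    qed
    then have none: "{e\<in>F. n \<in> e} = {}" by blast
    have linkn: "link_weight F n x = 0"
      unfolding link_weight_def none by simp
    have link2: "link_weight F 2 x = \<zeta> + x 1 * CB"
    proof -
      have sp: "{e\<in>F. 2 \<in> e} = {e\<in>FT. 2 \<in> e} \<union> {e\<in>F. 2 \<in> e \<and> 1 \<in> e}"
        unfolding FT_def by blast
      have "link_weight F 2 x = \<zeta> + (\<Sum>e\<in>{e\<in>F. 2 \<in> e \<and> 1 \<in> e}. p e)"
        unfolding link_weight_def sp \<zeta>_def p_def FT_def using fin(1) by (intro sum.union_disjoint) auto
      also have "(\<Sum>e\<in>{e\<in>F. 2 \<in> e \<and> 1 \<in> e}. p e) = (\<Sum>i\<in>{3..n} - B. x 1 * x i)"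
        unfolding both_sum
      proof (rule sum.cong[OF refl])
        fix i assume i: "i \<in> {3..n} - B"
        then have "{1, 2, i} - {2} = {1, i}" by auto
        then show "p {1, 2, i} = x 1 * x i" using i unfolding p_def by simp
      qed
      finally show ?thesis by (simp add: sum_distrib_left CB_def)
    qed
    have nB: "n \<in> B" using f12n n by (simp add: B_def)
    have "x n \<le> (\<Sum>i\<in>B. x i)"
      using nB finB BV x0 by (intro member_le_sum) auto
    define R where "R = 1 - x 2 - x n"
    have "x 1 * CB \<le> x 1 * R"
      using total CB \<open>x n \<le> (\<Sum>i\<in>B. x i)\<close> x12 unfolding R_def by (intro mult_left_mono) auto
    moreover have "(x n - x 2) * R = \<zeta> + x 1 * CB"
      using optimal_stationary[OF opt, of 2 n] n pos linkn link2 unfolding R_def by simp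
    ultimately have R: "(x n - x 2) * R \<le> x 1 * R + \<zeta>" by simp
    have "real (card ({1..n} - {2, n})) * x 1 \<le> (\<Sum>i\<in>{1..n} - {2, n}. x i)"
      by (rule sum_bounded_below) (use ord in simp)
    moreover have "card ({1..n} - {2, n}) = n - 2"
      using n by (simp add: card_Diff_subset)
    moreover have "(\<Sum>i\<in>{1..n} - {2, n}. x i) = R"
    proof -
      have "(\<Sum>i\<in>{1..n} - {2, n}. x i) = (\<Sum>i\<in>{1..n}. x i) - (\<Sum>i\<in>{2, n}. x i)"
        using n by (intro sum_diff) auto
      then show ?thesis
        using n xw unfolding R_def weightings_def by simp
    qed
    ultimately have RN: "real (n - 2) * x 1 \<le> R" by simp
    have bl': "real b * real (n - 2) \<le> 2 * real l"
      using bl by (simp only: of_nat_mult[symmetric] of_nat_numeral[symmetric, where 'a = real] of_nat_le_iff)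
    have "(\<Sum>i\<in>B. x i) \<le> real b * x n"
      unfolding b_def using BV ord by (intro sum_bounded_above) auto
    then have "(x 1)\<^sup>2 * (\<Sum>i\<in>B. x i) \<le> (x 1)\<^sup>2 * (real b * x n)"
      by (intro mult_left_mono) auto
    also have "\<dots> \<le> real l * (x 2 * (x 1)\<^sup>2) + x 1 * S"
      using x12 n S0 D(3) RN R bl' unfolding S_def[symmetric] \<zeta>_def[symmetric]
      by (intro merge_gain[where R = R and N = "real (n - 2)" and \<zeta> = \<zeta>]) auto
    finally show ?thesis .
  qed
  have "edge_weight F' y = edge_weight F y - edge_weight D y + edge_weight E1 y"
    unfolding F'_def using fin(1) finE1 dis DF by (simp add: edge_weight_union edge_weight_diff)
  moreover have "edge_weight E1 y = 0"
    unfolding edge_weight_def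
  proof (rule sum.neutral, rule ballI)
    fix e assume "e \<in> E1"
    then have "e \<in> triples_of {1..n}" "1 \<in> e" by (simp_all add: E1_def)
    then show "(\<Prod>i\<in>e. y i) = 0"
      using finite_edge[of e "{1..n}"] y(1) by (auto intro!: prod_zero)
  qed
  ultimately have "energy n F' y = energy n F y - edge_weight D y"
    by (simp add: energy_def)
  then have "energy n F' y \<le> energy n F x"
    using Ey gainD loss by linarith
  then show ?thesis
    using F'V cF' yw y(1) by blast
qed

text \<open>At most \<open>m\<close> edges, rather than exactly \<open>m\<close>: edges at a vertex of weight 0 are dropped together with it.\<close>

definition lagrangian_bound :: "nat \<Rightarrow> nat \<Rightarrow> real \<Rightarrow> bool" where
  "lagrangian_bound n m L \<longleftrightarrow> (\<forall>E x. E \<subseteq> triples_of {1..n} \<longrightarrow> card E \<le> m \<longrightarrow> x \<in> weightings n \<longrightarrow> edge_weight E x \<le> L)"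

lemma lagrangian_boundD:
  assumes "lagrangian_bound n m L" "E \<subseteq> triples_of {1..n}" "card E \<le> m" "x \<in> weightings n"
  shows "edge_weight E x \<le> L"
  using assms unfolding lagrangian_bound_def by blast

lemma triples_of_mono: "V \<subseteq> W \<Longrightarrow> triples_of V \<subseteq> triples_of W"
  unfolding triples_of_def by blast

lemma choose_three_mono:
  assumes "a \<le> b"
  shows "a choose 3 \<le> b choose (3::nat)"
proof -
  have "card (triples_of {1..a}) \<le> card (triples_of {1..b})"
    using assms by (intro card_mono finite_triples_of triples_of_mono) auto
  then show ?thesis
    by (simp add: card_triples_of)
qed

lemma edge_weight_without_zero:
  assumes "x v = 0" "E \<subseteq> triples_of {1..n}"
  shows "edge_weight E x = edge_weight {e\<in>E. v \<notin> e} x"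
proof -
  note fin = finite_triples_on[OF assms(2)]
  have "(\<Sum>e\<in>E. \<Prod>i\<in>e. x i) = (\<Sum>e\<in>{e\<in>E. v \<notin> e}. \<Prod>i\<in>e. x i)"
  proof (rule sum.mono_neutral_right[OF fin(1)])
    show "\<forall>e\<in>E - {e\<in>E. v \<notin> e}. (\<Prod>i\<in>e. x i) = 0"
    proof
      fix e assume "e \<in> E - {e\<in>E. v \<notin> e}"
      then have "e \<in> E" "v \<in> e" by simp_all
      then show "(\<Prod>i\<in>e. x i) = 0"
        using fin(2) assms(1) by (intro prod_zero) auto
    qed
  qed blast
  then show ?thesis by (simp add: edge_weight_def)
qed

lemma lagrangian_bound_drop_zero:
  assumes L: "lagrangian_bound (n - 1) m L" and n: "1 \<le> n"
    and E: "E \<subseteq> triples_of {1..n}" "card E \<le> m" and y: "y \<in> weightings n" "y 1 = 0"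
  shows "edge_weight E y \<le> L"
proof -
  define D where "D = {e\<in>E. 1 \<notin> e}"
  have finE: "finite E" by (rule finite_triples_on(1)[OF E(1)])
  have DV: "D \<subseteq> triples_of {2..n}"
  proof
    fix e assume "e \<in> D"
    then have e: "e \<in> triples_of {1..n}" "1 \<notin> e" using E(1) unfolding D_def by blast+
    have "e \<subseteq> {2..n}"
    proof
      fix i assume i: "i \<in> e"
      then have "i \<in> {1..n}" using e(1) unfolding triples_of_def by blast
      moreover have "i \<noteq> 1" using i e(2) by blast
      ultimately show "i \<in> {2..n}" by simp
    qed
    then show "e \<in> triples_of {2..n}" using e(1) by (simp add: triples_of_def)
  qed
  define f :: "nat \<Rightarrow> nat" where "f = (\<lambda>i. i - 1)"
  define w where "w = y \<circ> Suc"
  have f: "bij_betw f {2..n} {1..n - 1}"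
    unfolding f_def by (rule bij_betw_byWitness[where f' = Suc]) auto
  have inj: "inj_on f {2..n}" using f by (rule bij_betw_imp_inj_on)
  have "edge_weight E y = edge_weight D y"
    unfolding D_def by (rule edge_weight_without_zero[where v = 1]) (use y E in auto)
  also have "\<dots> = edge_weight D (w \<circ> f)"
  proof (rule edge_weight_cong)
    fix e i assume "e \<in> D" "i \<in> e"
    then have "i \<in> {2..n}" using DV unfolding triples_of_def by blast
    then show "y i = (w \<circ> f) i" by (simp add: w_def f_def)
  qed
  also have "\<dots> = edge_weight ((`) f ` D) w"
    by (rule edge_weight_image[OF inj DV, symmetric])
  also have "\<dots> \<le> L"
  proof (rule lagrangian_boundD[OF L])
    show "(`) f ` D \<subseteq> triples_of {1..n - 1}"
      using image_triples_of[OF f] DV by blast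
    have "card ((`) f ` D) \<le> card D"
      unfolding D_def by (rule card_image_le) (simp add: finE)
    also have "\<dots> \<le> card E"
      unfolding D_def by (rule card_mono[OF finE]) blast
    finally show "card ((`) f ` D) \<le> m" using E(2) by simp
    have "(\<Sum>i\<in>{1..n - 1}. w i) = (\<Sum>i\<in>{2..n}. w (f i))"
      by (rule sum.reindex_bij_betw[OF f, symmetric])
    also have "\<dots> = (\<Sum>i\<in>{2..n}. y i)"
      by (rule sum.cong) (auto simp: w_def f_def)
    also have "\<dots> = (\<Sum>i\<in>{1..n}. y i)"
      using n y(2) by (simp add: sum.atLeast_Suc_atMost numeral_2_eq_2)
    also have "\<dots> = 1" using y(1) by (simp add: weightings_def)
    finally have "(\<Sum>i\<in>{1..n - 1}. w i) = 1" .
    moreover have "0 \<le> w i" if "i \<in> {1..n - 1}" for i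
    proof -
      have "Suc i \<in> {1..n}" using that by auto
      then show ?thesis using y(1) by (simp add: w_def weightings_def)
    qed
    ultimately show "w \<in> weightings (n - 1)"
      by (simp add: weightings_def)
  qed
  finally show ?thesis .
qed

lemma lagrangian_bound_step:
  assumes L: "lagrangian_bound (n - 1) m L" and n: "6 \<le> n" and m: "m \<le> (n - 1) choose 3"
  shows "lagrangian_bound n m L"
  unfolding lagrangian_bound_def
proof (intro allI impI)
  fix E x assume E: "E \<subseteq> triples_of {1..n}" "card E \<le> m" and xw: "x \<in> weightings n"
  let ?T = "triples_of {1..n}"
  have finT: "finite ?T" by (rule finite_triples_of) simp
  have cT: "card ?T = n choose 3" by (simp add: card_triples_of)
  have compl: "card (?T - G) = (n choose 3) - card G" if "G \<subseteq> ?T" for G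
    using card_Diff_subset[OF finite_subset[OF that finT] that] cT by simp
  have cE: "card E \<le> n choose 3"
    using card_mono[OF finT E(1)] cT by simp
  have ETT: "?T - (?T - E) = E" using E(1) by blast
  have Fsub: "?T - E \<subseteq> ?T" by blast
  have "0 < n" "(n choose 3) - card E \<le> n choose 3" using n by simp_all
  then obtain F z where opt: "optimal n F z" and cF: "card F = (n choose 3) - card E" and sh: "shifted F"
    and ord: "\<forall>i j. 1 \<le> i \<longrightarrow> i \<le> j \<longrightarrow> j \<le> n \<longrightarrow> z i \<le> z j"
    using optimal_shifted_exists by blast
  have FV: "F \<subseteq> ?T" and zw: "z \<in> weightings n"
    using opt by (auto simp: optimal_def)
  have Ez: "energy n F z \<le> energy n (?T - E) x"
    using optimal_le[OF opt Fsub _ xw] compl[OF E(1)] cF by simp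
  have "\<exists>F' y. F' \<subseteq> ?T \<and> card F' = card F \<and> y \<in> weightings n \<and> y 1 = 0 \<and> energy n F' y \<le> energy n F z"
  proof (cases "z 1 = 0")
    case True
    then show ?thesis using FV zw by blast
  next
    case False
    have "0 \<le> z 1" using zw n by (simp add: weightings_def)
    then have z1: "0 < z 1" using False by simp
    have "\<forall>i\<in>{1..n}. 0 < z i"
    proof
      fix i assume "i \<in> {1..n}"
      then have "z 1 \<le> z i" using ord by simp
      then show "0 < z i" using z1 by simp
    qed
    moreover have "card (?T - F) \<le> (n - 1) choose 3"
      using compl[OF FV] cF cE E(2) m by simp
    ultimately show ?thesis
      using ord by (intro merge_lightest[OF opt _ _ sh n]) auto
  qed
  then obtain F' y where F': "F' \<subseteq> ?T" "card F' = card F" and y: "y \<in> weightings n" "y 1 = 0"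
    and Ey: "energy n F' y \<le> energy n F z" by blast
  have "edge_weight E x = 1 / 6 - energy n (?T - E) x"
    using edge_weight_complement[OF Fsub xw] ETT by simp
  also have "\<dots> \<le> 1 / 6 - energy n F' y"
    using Ey Ez by simp
  also have "\<dots> = edge_weight (?T - F') y"
    by (rule edge_weight_complement[OF F'(1) y(1), symmetric])
  also have "\<dots> \<le> L"
  proof (rule lagrangian_bound_drop_zero[OF L _ _ _ y])
    show "card (?T - F') \<le> m"
      using compl[OF F'(1)] F'(2) cF cE E(2) by simp
  qed (use n in auto)
  finally show "edge_weight E x \<le> L" .
qed

lemma lagrangian_bound_less:
  assumes L: "lagrangian_bound t m L" and n: "n \<le> t"
  shows "lagrangian_bound n m L"
  unfolding lagrangian_bound_def
proof (intro allI impI)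
  fix E x assume E: "E \<subseteq> triples_of {1..n}" "card E \<le> m" and xw: "x \<in> weightings n"
  define y where "y = (\<lambda>i. if i \<in> {1..n} then x i else 0)"
  have "(\<Sum>i\<in>{1..t}. y i) = (\<Sum>i\<in>{1..n}. y i)"
    using n by (intro sum.mono_neutral_right) (auto simp: y_def)
  also have "\<dots> = (\<Sum>i\<in>{1..n}. x i)"
    by (rule sum.cong) (auto simp: y_def)
  finally have yw: "y \<in> weightings t"
    using xw by (auto simp: weightings_def y_def)
  have "edge_weight E x = edge_weight E y"
  proof (rule edge_weight_cong)
    fix e i assume "e \<in> E" "i \<in> e"
    then have "i \<in> {1..n}" using E(1) unfolding triples_of_def by blast
    then show "x i = y i" by (simp add: y_def)
  qed
  also have "\<dots> \<le> L"
  proof (rule lagrangian_boundD[OF L _ E(2) yw])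
    have "triples_of {1..n} \<subseteq> triples_of {1..t}" using n by (intro triples_of_mono) simp
    then show "E \<subseteq> triples_of {1..t}" using E(1) by blast
  qed
  finally show "edge_weight E x \<le> L" .
qed

lemma lagrangian_bound_all:
  assumes L: "lagrangian_bound t m L" and t: "5 \<le> t" and m: "m \<le> t choose 3"
  shows "lagrangian_bound n m L"
proof (cases "n \<le> t")
  case True
  then show ?thesis by (rule lagrangian_bound_less[OF L])
next
  case False
  then have "t \<le> n" by simp
  then show ?thesis
  proof (induction n rule: dec_induct)
    case base
    then show ?case by (rule L)
  next
    case (step k)
    show ?case
    proof (rule lagrangian_bound_step)
      show "m \<le> (Suc k - 1) choose 3"
        using m choose_three_mono[OF step(1)] by simp
    qed (use step t in simp_all)
  qed
qed

section \<open>Comparison with the colex graph\<close>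

text \<open>Weight that is missing from a total of 1 can be added anywhere, since edge weights are monotone.\<close>

lemma edge_weight_le_lagrangian:
  assumes G: "three_graph n E" and n: "0 < n"
    and z: "\<And>i. i \<in> {1..n} \<Longrightarrow> 0 \<le> z i" "(\<Sum>i\<in>{1..n}. z i) \<le> 1"
  shows "edge_weight E z \<le> lagrangian n E"
proof -
  define r where "r = 1 - (\<Sum>i\<in>{1..n}. z i)"
  define y where "y = z(1 := z 1 + r)"
  have r: "0 \<le> r" using z(2) by (simp add: r_def)
  have zy: "z i \<le> y i" for i using r by (simp add: y_def)
  have "(\<Sum>i\<in>{1..n}. y i) = (\<Sum>i\<in>{1..n}. z i) + (\<Sum>i\<in>{1}. y i - z i)"
    using n by (intro sum_local_change) (auto simp: y_def)
  then have "(\<Sum>i\<in>{1..n}. y i) = 1" by (simp add: y_def r_def)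
  moreover have "0 \<le> y i" if "i \<in> {1..n}" for i
    using z(1)[OF that] zy[of i] by linarith
  ultimately have yw: "y \<in> weightings n" by (simp add: weightings_def)
  have "edge_weight E z \<le> edge_weight E y"
    unfolding edge_weight_def
  proof (intro sum_mono prod_mono conjI)
    fix e i assume "e \<in> E" "i \<in> e"
    then have "i \<in> {1..n}" using G unfolding three_graph_def by blast
    then show "0 \<le> z i" by (rule z(1))
  qed (rule zy)
  moreover obtain x where "edge_weight E x = lagrangian n E"
    "\<forall>y\<in>weightings n. edge_weight E y \<le> edge_weight E x"
    using lagrangian_attained[OF G n] by blast
  ultimately show ?thesis
    using yw by fastforce
qed

text \<open>The weighting may live on a vertex set other than that of the colex graph; its values outside the latter are discarded.\<close>

lemma colex_bound:
  assumes m: "0 < m" and E: "E \<subseteq> colex_edges m" "E \<subseteq> triples_of {1..t}" and z: "z \<in> weightings t"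
  shows "edge_weight E z \<le> lagrangian (colex_order m) (colex_edges m)"
proof -
  let ?C = "colex_edges m" and ?N = "colex_order m"
  have finC: "finite ?C" and cC: "card ?C = m"
    using finite_card_colex_edges[of m] by auto
  have G: "three_graph ?N ?C" by (rule three_graph_colex)
  have "0 < ?N"
  proof (rule ccontr)
    assume "\<not> 0 < ?N"
    then have none: "{1..?N} = {}" by simp
    have "?C \<noteq> {}" using cC m by auto
    then obtain e where "e \<in> ?C" by blast
    then have "e \<subseteq> {}" "card e = 3" using G unfolding three_graph_def none by blast+
    then show False by simp
  qed
  define y where "y = (\<lambda>i. if i \<in> {1..t} then z i else 0)"
  have y0: "0 \<le> y i" for i
    using z by (auto simp: y_def weightings_def)
  have "(\<Sum>i\<in>{1..?N}. y i) = (\<Sum>i\<in>{1..?N} \<inter> {1..t}. y i)"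
    by (rule sum.mono_neutral_right) (auto simp: y_def)
  also have "\<dots> \<le> (\<Sum>i\<in>{1..t}. y i)"
    using y0 by (intro sum_mono2) auto
  also have "\<dots> = (\<Sum>i\<in>{1..t}. z i)"
    by (rule sum.cong) (auto simp: y_def)
  finally have sum: "(\<Sum>i\<in>{1..?N}. y i) \<le> 1"
    using z by (simp add: weightings_def)
  have "edge_weight E z = edge_weight E y"
  proof (rule edge_weight_cong)
    fix e i assume "e \<in> E" "i \<in> e"
    then have "i \<in> {1..t}" using E(2) unfolding triples_of_def by blast
    then show "z i = y i" by (simp add: y_def)
  qed
  also have "\<dots> \<le> edge_weight ?C y"
    by (rule edge_weight_mono[OF finC E(1) y0])
  also have "\<dots> \<le> lagrangian ?N ?C"
    by (rule edge_weight_le_lagrangian[OF G \<open>0 < ?N\<close> y0 sum])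
  finally show ?thesis .
qed

text \<open>A member of a downward closed set has all its predecessors in that set, hence fewer of them than the set has members.\<close>

lemma colex_initial_segment:
  assumes S: "finite S" "S \<subseteq> triples" "card S \<le> m"
    and down: "\<And>A B. A \<in> S \<Longrightarrow> B \<in> triples \<Longrightarrow> colex_less B A \<Longrightarrow> B \<in> S"
  shows "S \<subseteq> colex_edges m"
proof
  fix A assume A: "A \<in> S"
  have "{B \<in> triples. colex_less B A} \<subseteq> S - {A}"
    using down[OF A] colex_less_irrefl by blast
  then have "card {B \<in> triples. colex_less B A} \<le> card (S - {A})"
    using S(1) by (intro card_mono) auto
  also have "\<dots> < card S"
    using S(1) A by (rule card_Diff1_less)
  finally show "A \<in> colex_edges m"
    using A S(2,3) unfolding colex_edges_def by auto
qed

lemma triples_of_subset_triples: "triples_of {1..n} \<subseteq> triples"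
  unfolding triples_of_def triples_def by auto

lemma colex_less_triples_of:
  assumes "A \<in> triples_of {1..n}" "B \<in> triples" "colex_less B A"
  shows "B \<in> triples_of {1..n}"
proof -
  have A: "A \<in> triples" using assms(1) triples_of_subset_triples by blast
  then obtain k where k: "k \<in> A" "\<forall>j>k. j \<in> B \<longleftrightarrow> j \<in> A"
    using colex_less_iff[OF finite_triple[OF assms(2)] finite_triple[OF A]] assms(3) by blast
  have "B \<subseteq> {1..n}"
  proof
    fix b assume b: "b \<in> B"
    have "1 \<le> b" using b assms(2) unfolding triples_def by auto
    moreover have "b \<le> n"
    proof (cases "b \<le> k")
      case True
      have "k \<in> {1..n}" using k(1) assms(1) unfolding triples_of_def by blast
      then show ?thesis using True by simp
    next
      case False
      then have "b \<in> A" using k(2) b by simp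
      then have "b \<in> {1..n}" using assms(1) unfolding triples_of_def by blast
      then show ?thesis by simp
    qed
    ultimately show "b \<in> {1..n}" by simp
  qed
  then show ?thesis
    using assms(2) by (simp add: triples_of_def triples_def)
qed

lemma colex_contains_clique:
  assumes "s choose 3 \<le> m"
  shows "triples_of {1..s} \<subseteq> colex_edges m"
proof (rule colex_initial_segment)
  show "finite (triples_of {1..s})" by (rule finite_triples_of) simp
  show "triples_of {1..s} \<subseteq> triples" by (rule triples_of_subset_triples)
  show "card (triples_of {1..s}) \<le> m" using assms by (simp add: card_triples_of)
qed (rule colex_less_triples_of)

lemma colex_contains_star_complement:
  assumes a: "a + 2 \<le> t" and m: "m + a = t choose 3"
  shows "triples_of {1..t} - (`) (\<lambda>i. t + 1 - i) ` star (a + 2) \<subseteq> colex_edges m"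
proof (rule colex_initial_segment)
  let ?T = "triples_of {1..t}" and ?S = "(`) (\<lambda>i. t + 1 - i) ` star (a + 2)"
  have S: "A \<in> ?S \<longleftrightarrow> (\<exists>c. t - 1 - a \<le> c \<and> c \<le> t - 2 \<and> A = {t, t - 1, c})" for A
  proof
    assume "A \<in> ?S"
    then obtain i where i: "i \<in> {3..a + 2}" "A = (\<lambda>i. t + 1 - i) ` {1, 2, i}"
      unfolding star_def image_image by (rule imageE)
    have "A = {t, t - 1, t + 1 - i}" unfolding i(2) by simp
    moreover have "3 \<le> i" "i \<le> a + 2" using i(1) by simp_all
    then have "t - 1 - a \<le> t + 1 - i" "t + 1 - i \<le> t - 2" using a by linarith+
    ultimately show "\<exists>c. t - 1 - a \<le> c \<and> c \<le> t - 2 \<and> A = {t, t - 1, c}"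
      by (intro exI[of _ "t + 1 - i"] conjI)
  next
    assume "\<exists>c. t - 1 - a \<le> c \<and> c \<le> t - 2 \<and> A = {t, t - 1, c}"
    then obtain c where c: "t - 1 - a \<le> c" "c \<le> t - 2" "A = {t, t - 1, c}" by (elim exE conjE)
    have "A = (\<lambda>i. t + 1 - i) ` {1, 2, t + 1 - c}"
      using c a by simp
    moreover have "3 \<le> t + 1 - c" "t + 1 - c \<le> a + 2"
      using c(1,2) a by linarith+
    then have "{1, 2, t + 1 - c} \<in> star (a + 2)"
      unfolding star_def by (intro imageI) simp
    ultimately show "A \<in> ?S" by (rule image_eqI)
  qed
  have finT: "finite ?T" by (rule finite_triples_of) simp
  show "finite (?T - ?S)" using finT by simp
  show "?T - ?S \<subseteq> triples" using triples_of_subset_triples by blast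
  have bij: "bij_betw (\<lambda>i. t + 1 - i) {1..t} {1..t}"
    by (rule bij_betw_byWitness[where f' = "\<lambda>i. t + 1 - i"]) auto
  have starV: "star (a + 2) \<subseteq> ?T" by (rule star_subset[OF a])
  have SV: "?S \<subseteq> ?T" using image_triples_of[OF bij] starV by blast
  have "card ?S = a"
    using card_relabel[OF bij starV] by (simp add: card_star)
  then have "card (?T - ?S) = (t choose 3) - a"
    using card_Diff_subset[OF finite_subset[OF SV finT] SV] by (simp add: card_triples_of)
  then show "card (?T - ?S) \<le> m" using m by simp
  fix A B assume A: "A \<in> ?T - ?S" and B: "B \<in> triples" and BA: "colex_less B A"
  have AT: "A \<in> triples" using A triples_of_subset_triples by blast
  have "B \<notin> ?S"
  proof
    assume "B \<in> ?S"
    then obtain c where c: "t - 1 - a \<le> c" "c \<le> t - 2" "B = {t, t - 1, c}"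
      unfolding S by (elim exE conjE)
    obtain k where k: "k \<in> A" "k \<notin> B" "\<forall>j>k. j \<in> B \<longleftrightarrow> j \<in> A"
      using colex_less_iff[OF finite_triple[OF B] finite_triple[OF AT]] BA by blast
    have "k \<in> {1..t}" using A k(1) unfolding triples_of_def by blast
    moreover have "k \<noteq> t" "k \<noteq> t - 1" using k(2) unfolding c(3) by simp_all
    ultimately have kt: "k < t - 1" unfolding atLeastAtMost_iff by arith
    have tA: "t \<in> A" "t - 1 \<in> A"
      using k(3)[rule_format, of t] k(3)[rule_format, of "t - 1"] kt unfolding c(3) by simp_all
    have cA: "card A = 3" using AT by (simp add: triples_def)
    have "{t, t - 1, k} \<subseteq> A" using tA k(1) by blast
    moreover have "t \<noteq> t - 1" "k \<noteq> t" "k \<noteq> t - 1" using kt by linarith+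
    then have "card {t, t - 1, k} = 3" by simp
    ultimately have Ak: "A = {t, t - 1, k}"
      using card_subset_eq[OF finite_triple[OF AT], of "{t, t - 1, k}"] cA by simp
    have "\<not> k < c"
    proof
      assume "k < c"
      then have "c \<in> A" using k(3)[rule_format, of c] unfolding c(3) by simp
      then show False using \<open>k < c\<close> c(2) kt unfolding Ak by auto
    qed
    moreover have "k \<noteq> c" using k(2) unfolding c(3) by simp
    ultimately have "c < k" by simp
    then have "t - 1 - a \<le> k \<and> k \<le> t - 2 \<and> A = {t, t - 1, k}"
      using c(1) kt Ak by (intro conjI) linarith+
    then have "A \<in> ?S" unfolding S by (rule exI)
    then show False using A by simp
  qed
  then show "B \<in> ?T - ?S"
    using colex_less_triples_of[OF _ B BA] A by simp
qed

text \<open>No triple containing 1 and 2 is an edge, so the edge weight depends only on the sum of these two weights.\<close>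

lemma star_merge:
  assumes t: "2 \<le> t" and z: "z \<in> weightings t"
  defines "y \<equiv> z(1 := 0, 2 := z 1 + z 2)"
  shows "y \<in> weightings t" "energy t (star t) y = energy t (star t) z"
proof -
  have "{1..t} = {1, 2} \<union> {3..t}" using t by auto
  moreover have "(\<Sum>i\<in>{1, 2} \<union> {3..t}. z i) = (\<Sum>i\<in>{1, 2}. z i) + (\<Sum>i\<in>{3..t}. z i)"
    by (intro sum.union_disjoint) auto
  ultimately have total: "(\<Sum>i\<in>{3..t}. z i) = 1 - z 1 - z 2"
    using z by (simp add: weightings_def)
  have y: "y 1 = 0" "y 2 = z 1 + z 2" "\<And>i. i \<notin> {1, 2} \<Longrightarrow> y i = z i"
    by (auto simp: y_def)
  have S: "{1, 2} \<subseteq> {1..t}" using t by auto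
  have "(\<Sum>i\<in>{1..t}. y i) = (\<Sum>i\<in>{1..t}. z i) + (\<Sum>i\<in>{1, 2}. y i - z i)"
    using S y(3) by (intro sum_local_change) auto
  then have "(\<Sum>i\<in>{1..t}. y i) = 1"
    using y z by (simp add: weightings_def)
  moreover have "0 \<le> y i" if "i \<in> {1..t}" for i
    using that z t by (auto simp: y_def weightings_def)
  ultimately show "y \<in> weightings t" by (simp add: weightings_def)
  have "(\<Sum>i\<in>{1..t}. profile (y i)) = (\<Sum>i\<in>{1..t}. profile (z i)) + (\<Sum>i\<in>{1, 2}. profile (y i) - profile (z i))"
    using S y(3) by (intro sum_local_change) auto
  also have "(\<Sum>i\<in>{1, 2}. profile (y i) - profile (z i)) = z 1 * z 2 * (1 - z 1 - z 2)"
    using y(1,2) by (simp add: profile_def field_simps power2_eq_square power3_eq_cube)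
  finally have P: "(\<Sum>i\<in>{1..t}. profile (y i)) = (\<Sum>i\<in>{1..t}. profile (z i)) + z 1 * z 2 * (1 - z 1 - z 2)" .
  show "energy t (star t) y = energy t (star t) z"
    unfolding energy_def edge_weight_star P total y(1) by simp
qed

text \<open>Only \<open>min a (t - 2)\<close> of the missing triples are used, since a star on \<open>t\<close> vertices has no more. If this is less
than \<open>a\<close>, a star with \<open>t - 2\<close> leaves makes the vertices 1 and 2 mergeable, and the complete graph on the remaining
\<open>t - 1\<close> vertices lies in the colex graph because \<open>(t - 1 choose 2) \<ge> 6\<close>.\<close>

lemma colex_lagrangian_bound:
  assumes t: "5 \<le> t" and a: "3 \<le> a" "a \<le> 6" and m: "m + a = t choose 3"
  shows "lagrangian_bound t m (lagrangian (colex_order m) (colex_edges m))"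
  unfolding lagrangian_bound_def
proof (intro allI impI)
  let ?T = "triples_of {1..t}" and ?L = "lagrangian (colex_order m) (colex_edges m)"
  let ?r = "\<lambda>i. t + 1 - i"
  fix E x assume E: "E \<subseteq> ?T" "card E \<le> m" and xw: "x \<in> weightings t"
  have clique: "(t - 1) choose 3 \<le> m"
  proof -
    have "4 * 3 \<le> (t - 1) * (t - 1 - 1)"
      using t by (intro mult_le_mono) auto
    then have "6 \<le> (t - 1) choose 2"
      unfolding choose_two by simp
    moreover have "t choose 3 = ((t - 1) choose 3) + ((t - 1) choose 2)"
      using t binomial_Suc_Suc[of "t - 1" 2] by (simp add: numeral_3_eq_3 numeral_2_eq_2)
    ultimately show ?thesis using m a(2) by simp
  qed
  have "0 < (t - 1) choose 3"
    using t by (intro zero_less_binomial) simp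
  then have m0: "0 < m" using clique by (rule less_le_trans)
  have finT: "finite ?T" by (rule finite_triples_of) simp
  have bij: "bij_betw ?r {1..t} {1..t}"
    by (rule bij_betw_byWitness[where f' = ?r]) auto
  have inj: "inj_on ?r {1..t}" using bij by (rule bij_betw_imp_inj_on)
  define a' where "a' = min a (t - 2)"
  have a': "a' + 2 \<le> t" "a' \<le> 6" using t a by (auto simp: a'_def)
  have "card (?T - E) = (t choose 3) - card E"
    using card_Diff_subset[OF finite_subset[OF E(1) finT] E(1)] by (simp add: card_triples_of)
  then have "a' \<le> card (?T - E)" using E(2) m by (simp add: a'_def)
  then obtain F where F: "F \<subseteq> ?T - E" "card F = a'"
    by (rule obtain_subset_with_card_n) blast
  have FV: "F \<subseteq> ?T" using F(1) by blast
  have "\<exists>z\<in>weightings t. energy t (star (card F + 2)) z \<le> energy t F x"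
    using F(2) a' by (intro star_minimises_energy[OF FV _ _ xw]) simp_all
  then obtain z where zw: "z \<in> weightings t" and Ez: "energy t (star (a' + 2)) z \<le> energy t F x"
    unfolding F(2) by (elim bexE)
  have starV: "star (a' + 2) \<subseteq> ?T" by (rule star_subset[OF a'(1)])
  have "edge_weight E x \<le> edge_weight (?T - F) x"
  proof (rule edge_weight_mono)
    show "E \<subseteq> ?T - F" using E(1) F(1) by blast
    fix e i assume "e \<in> ?T - F" "i \<in> e"
    then have "i \<in> {1..t}" unfolding triples_of_def by blast
    then show "0 \<le> x i" using xw by (simp add: weightings_def)
  qed (use finT in simp)
  also have "\<dots> \<le> edge_weight (?T - star (a' + 2)) z"
    using Ez edge_weight_complement[OF FV xw] edge_weight_complement[OF starV zw] by simp
  finally have le: "edge_weight E x \<le> edge_weight (?T - star (a' + 2)) z" .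
  have rr: "edge_weight D y = edge_weight ((`) ?r ` D) (y \<circ> ?r)" if D: "D \<subseteq> ?T" for D y
  proof -
    have "edge_weight ((`) ?r ` D) (y \<circ> ?r) = edge_weight D (y \<circ> ?r \<circ> ?r)"
      by (rule edge_weight_image[OF inj D])
    also have "\<dots> = edge_weight D y"
    proof (rule edge_weight_cong)
      fix e i assume "e \<in> D" "i \<in> e"
      then have "i \<in> {1..t}" using D unfolding triples_of_def by blast
      then show "(y \<circ> ?r \<circ> ?r) i = y i" by simp
    qed
    finally show ?thesis by simp
  qed
  show "edge_weight E x \<le> ?L"
  proof (cases "a \<le> t - 2")
    case True
    then have aa: "a' = a" by (simp add: a'_def)
    have "(`) ?r ` (?T - star (a + 2)) \<subseteq> ?T - (`) ?r ` star (a + 2)"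
    proof (intro subsetI DiffI)
      fix e assume "e \<in> (`) ?r ` (?T - star (a + 2))"
      then obtain d where "e = ?r ` d" "d \<in> ?T - star (a + 2)" by (rule imageE)
      note d = DiffD1[OF this(2)] DiffD2[OF this(2)] this(1)
      show "e \<in> ?T"
        using imageI[OF d(1), of "(`) ?r"] unfolding image_triples_of[OF bij] d(3) .
      show "e \<notin> (`) ?r ` star (a + 2)"
      proof
        assume "e \<in> (`) ?r ` star (a + 2)"
        then obtain d' where d': "e = ?r ` d'" "d' \<in> star (a + 2)" by (rule imageE)
        then have "d' \<in> ?T" using starV unfolding aa by (intro subsetD[OF starV]) (simp add: aa)
        then have "d' \<subseteq> {1..t}" "d \<subseteq> {1..t}" using d(1) by (simp_all add: triples_of_def)
        then have "?r ` d = ?r ` d' \<longleftrightarrow> d = d'"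
          by (intro inj_on_image_eq_iff[OF inj])
        then have "d = d'"
          unfolding d(3)[symmetric] d'(1)[symmetric] by simp
        then show False using d(2) d'(2) by simp
      qed
    qed
    also have sub: "\<dots> \<subseteq> colex_edges m"
      using True t by (intro colex_contains_star_complement[OF _ m]) simp
    finally have inC: "(`) ?r ` (?T - star (a + 2)) \<subseteq> colex_edges m" .
    have "edge_weight (?T - star (a + 2)) z = edge_weight ((`) ?r ` (?T - star (a + 2))) (z \<circ> ?r)"
      by (rule rr[OF Diff_subset])
    also have "\<dots> \<le> ?L"
    proof (rule colex_bound[OF m0 inC _ weightings_relabel[OF bij zw]])
      have "(`) ?r ` (?T - star (a + 2)) \<subseteq> (`) ?r ` ?T"
        by (intro image_mono Diff_subset)
      then show "(`) ?r ` (?T - star (a + 2)) \<subseteq> ?T"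
        unfolding image_triples_of[OF bij] .
    qed
    finally show ?thesis using le aa by simp
  next
    case False
    then have aa: "a' + 2 = t" using t by (simp add: a'_def)
    define y where "y = z(1 := 0, 2 := z 1 + z 2)"
    have yw: "y \<in> weightings t" and Ey: "energy t (star t) y = energy t (star t) z"
      unfolding y_def using star_merge[OF _ zw] t by simp_all
    have starT: "star t \<subseteq> ?T" by (rule star_subset) simp
    define w where "w = y \<circ> ?r"
    have ww: "w \<in> weightings t" unfolding w_def by (rule weightings_relabel[OF bij yw])
    have "edge_weight (?T - star t) z = edge_weight (?T - star t) y"
      using edge_weight_complement[OF starT yw] edge_weight_complement[OF starT zw] Ey by simp
    also have "\<dots> \<le> edge_weight ?T y"
    proof (rule edge_weight_mono[OF finT])
      fix e i assume "e \<in> ?T" "i \<in> e"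
      then have "i \<in> {1..t}" unfolding triples_of_def by blast
      then show "0 \<le> y i" using yw by (simp add: weightings_def)
    qed blast
    also have "\<dots> = edge_weight ?T w"
      using rr[OF order_refl, of y] unfolding image_triples_of[OF bij] w_def .
    also have "\<dots> = edge_weight {e\<in>?T. t \<notin> e} w"
      by (rule edge_weight_without_zero[where n = t]) (simp_all add: w_def y_def)
    also have "{e\<in>?T. t \<notin> e} = triples_of {1..t - 1}"
    proof -
      have "{1..t - 1} = {1..t} - {t}" by auto
      show ?thesis
        unfolding \<open>{1..t - 1} = {1..t} - {t}\<close> triples_of_def subset_Diff_insert by (simp add: conj_ac)
    qed
    also have "edge_weight (triples_of {1..t - 1}) w \<le> ?L"
      by (rule colex_bound[OF m0 colex_contains_clique[OF clique] _ ww]) (rule triples_of_mono, simp)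
    finally show ?thesis using le aa by simp
  qed
qed

lemma single_edge_bound:
  assumes E: "E \<subseteq> triples_of {1..n}" "card E = 1" and xw: "x \<in> weightings n"
  shows "edge_weight E x \<le> lagrangian (colex_order 1) (colex_edges 1)"
proof -
  obtain e where e: "E = {e}" using E(2) card_1_singletonE by blast
  then have "e \<in> E" by simp
  then obtain a b c where abc: "e = {a, b, c}" "1 \<le> a" "a < b" "b < c" "c \<le> n"
    using E(1) by (rule sorted_edge_cases)
  have "(\<Sum>i\<in>{a, b, c}. x i) \<le> 1"
    using abc(2-5) by (intro weightings_sum_le[OF xw]) auto
  then have sum: "x a + x b + x c \<le> 1" using abc(3,4) by simp
  have x0: "0 \<le> x a" "0 \<le> x b" "0 \<le> x c"
    using xw abc(2-5) by (auto simp: weightings_def)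
  \<comment> \<open>The third vertex takes all the remaining weight, so that the total is 1.\<close>
  define z where "z = (\<lambda>i::nat. if i = 1 then x a else if i = 2 then x b else 1 - x a - x b)"
  have T: "triples_of {1..3} = {{1, 2, 3}}"
  proof (intro equalityI subsetI)
    fix d assume d: "d \<in> triples_of {1..3}"
    then have "d = {1..3}"
      by (intro card_subset_eq) (auto simp: triples_of_def)
    moreover have "{1..3} = {1, 2, 3::nat}" by auto
    ultimately show "d \<in> {{1, 2, 3}}" by simp
  qed (simp add: triples_of_def)
  have I: "{1..3} = {1, 2, 3::nat}" by auto
  have zw: "z \<in> weightings 3"
    unfolding weightings_def I using x0 sum by (simp add: z_def)
  have "edge_weight E x = x a * x b * x c"
    using abc(3,4) unfolding e abc(1) by (simp add: edge_weight_def)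
  also have "\<dots> \<le> x a * x b * (1 - x a - x b)"
    using x0 sum by (intro mult_left_mono) auto
  also have "\<dots> = edge_weight (triples_of {1..3}) z"
    unfolding T by (simp add: edge_weight_def z_def)
  also have "\<dots> \<le> lagrangian (colex_order 1) (colex_edges 1)"
    by (rule colex_bound[OF _ colex_contains_clique _ zw]) simp_all
  finally show ?thesis .
qed

theorem corollary1p13:
  fixes m t n :: nat and E :: "nat set set"
  assumes "0 < m" and "0 < t"
    and "int (t choose 3) - 6 \<le> int m"
    and "int m \<le> int (t choose 3) - 3"
    and "three_graph n E"
    and "card E = m"
  shows "lagrangian n E \<le> lagrangian (colex_order m) (colex_edges m)"
proof -
  have E: "E \<subseteq> triples_of {1..n}"
    using assms(5) by (simp add: three_graph_def triples_of_def)
  have "0 < n"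
  proof (rule ccontr)
    assume "\<not> 0 < n"
    then have "triples_of {1..n} = {}" by (auto simp: triples_of_def)
    then show False using E assms(1,6) by simp
  qed
  then obtain x where xw: "x \<in> weightings n" and x: "edge_weight E x = lagrangian n E"
    using lagrangian_attained[OF assms(5)] by blast
  have "edge_weight E x \<le> lagrangian (colex_order m) (colex_edges m)"
  proof (cases "5 \<le> t")
    case True
    define a where "a = (t choose 3) - m"
    have a: "3 \<le> a" "a \<le> 6" "m + a = t choose 3"
      using assms(3,4) by (auto simp: a_def)
    have "lagrangian_bound n m (lagrangian (colex_order m) (colex_edges m))"
      using a by (intro lagrangian_bound_all[OF colex_lagrangian_bound[OF True a]] True) simp
    then show ?thesis
      using E xw assms(6) by (intro lagrangian_boundD) auto
  next
    case False
    then have "t choose 3 \<le> 4 choose 3" by (intro choose_three_mono) simp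
    also have "4 choose 3 = (4::nat)" by (simp add: numeral_eq_Suc)
    finally have "m = 1" using assms(1,4) by simp
    then show ?thesis using single_edge_bound[OF E _ xw] assms(6) by simp
  qed
  then show ?thesis using x by simp
qed

end
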